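(* Let $G=C_7\times C_7$. The least positive element of $S(G)$ divisible by $7$ is $43\cdot7^{10}$. The least positive element of $S(G)$ whose $7$-adic valuation is exactly $11$ is $8\cdot7^{11}$. In particular, $\pm7^{10}\notin S(G)$ and $\pm7^{11}\notin S(G)$, whereas $7^{12}\mathbb Z\subseteq S(G)$.
   Context: For a finite group $G$ and $v=(v_g)_{g\in G}\in\mathbb Z^{|G|}$, $\Theta_G(v)=\det(v_{gh^{-1}})_{g,h\in G}$ and $S(G)=\{\Theta_G(v): v\in\mathbb Z^{|G|}\}$. *)

theory Defs
  imports "HOL-Analysis.Determinants" "HOL-Computational_Algebra.Primes"
begin

text \<open>
  A finite group is a type of class \<^class>\<open>finite\<close> and \<^class>\<open>group_add\<close>. That class does not
  assume commutativity; only the notation is additive, so the entry \<open>v\<^bsub>gh\<inverse>\<^esub>\<close> of the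
  group matrix is written \<open>v $ (g - h)\<close>.
\<close>

definition group_det :: "(int, 'g::{finite, group_add}) vec \<Rightarrow> int" where
  "group_det v = det (\<chi> g h. v $ (g - h))"

definition group_dets :: "'g::{finite, group_add} itself \<Rightarrow> int set" where
  "group_dets _ = range (group_det :: (int, 'g) vec \<Rightarrow> int)"

text \<open>
  The numeral type \<^typ>\<open>7\<close> is the ring of integers modulo 7, so its additive group is the
  cyclic group of order 7, and \<^typ>\<open>7 \<times> 7\<close> carries the componentwise addition.
\<close>

type_synonym C7xC7 = "7 \<times> 7"

definition is_least :: "'a::order set \<Rightarrow> 'a \<Rightarrow> bool" where
  "is_least A x \<longleftrightarrow> x \<in> A \<and> (\<forall>y\<in>A. x \<le> y)"

end

theory Submission
  imports Defs
begin

text \<open>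
  Let \<open>F(x, y)\<close> be the element of the group ring with coefficients \<open>v\<close>. The determinant is the product
  of \<open>F(1, 1)\<close>, of the norms \<open>N\<^sub>b\<close> of \<open>F(\<omega>, \<omega>\<^sup>b)\<close> for the seven residues \<open>b\<close>, and of the norm \<open>N'\<close> of
  \<open>F(1, \<omega>)\<close>, where \<open>\<omega>\<close> is a primitive seventh root of unity. If 7 divides the determinant, then it
  divides \<open>F(1, 1)\<close>; let \<open>A\<close> and \<open>B\<close> be the moments of \<open>v\<close> of first order modulo 7. If both vanish,
  all norms are divisible by 49. Otherwise an automorphism of the group achieves \<open>B = 0\<close>, and then
  \<open>N\<^sub>b = 7 m\<^sub>b\<close> with \<open>m\<^sub>b \<equiv> 1\<close> modulo 7, while 49 divides \<open>N'\<close>.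

  Here \<open>m\<^sub>b\<close> is the norm of \<open>\<alpha>\<^sub>b = F(\<omega>, \<omega>\<^sup>b) / (\<omega> - 1)\<close>. Taking the norm through the field of
  \<open>\<surd>(-7)\<close> gives \<open>4 m\<^sub>b = X\<^sub>b\<^sup>2 + 7 Y\<^sub>b\<^sup>2\<close>, where \<open>Y\<^sub>b\<close> modulo 7 is a third cumulant of the coefficients
  of \<open>\<alpha>\<^sub>b\<close>, hence a polynomial in \<open>b\<close> of degree at most 6. Its leading coefficient is a multiple of
  the cube of the second moment \<open>C\<close> of \<open>v\<close> in the second variable, so \<open>\<Sum> Y\<^sub>b \<equiv> -2 C\<^sup>3\<close>. If \<open>C\<close> is
  nonzero, then not all \<open>Y\<^sub>b\<close> vanish. If the product of the \<open>m\<^sub>b\<close> were less than 43, exactly one \<open>m\<^sub>b\<close>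
  would differ from 1; then \<open>Y\<^sub>b\<^sup>2 \<equiv> 4\<close> forces \<open>m\<^sub>b = 8\<close> with \<open>\<alpha>\<^sub>b\<close> divisible by 2, but then its norm
  would be divisible by 64.

  If \<open>C = 0\<close>, then \<open>7\<^sup>3\<close> divides \<open>N'\<close>, and the cofactors of the powers of 7 cannot all be 1: a unit
  \<open>u\<close> satisfies \<open>cnj u = \<plusminus> \<omega>\<^sup>j u\<close>, so that
  \<open>F(\<omega>\<^sup>-\<^sup>1, \<omega>\<^sup>-\<^sup>b) = - \<omega>\<^bsup>P + b Q\<^esup> F(\<omega>, \<omega>\<^sup>b)\<close> for suitable \<open>P\<close> and \<open>Q\<close>. The coefficients of
  \<open>F(x\<^sup>-\<^sup>1, y\<^sup>-\<^sup>1) + x\<^sup>P y\<^sup>Q F(x, y)\<close> are therefore constant along \<open>x\<close>; comparing with the same relation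
  for \<open>F(1, \<omega>)\<close> shows that they are constant, which makes \<open>F(1, 1)\<close> divisible by 49.
\<close>

section \<open>Arithmetic modulo 7\<close>

lemma exhaust_Z7: "(x::7) = 0 \<or> x = 1 \<or> x = 2 \<or> x = 3 \<or> x = 4 \<or> x = 5 \<or> x = 6"
proof -
  have "x = of_int (Rep_bit1 x)"
    using bit1.Rep_mod[of x] by (simp add: bit1.of_int_eq bit1.Rep_bit1_inverse)
  moreover have "Rep_bit1 x \<in> {0..<7}"
    using bit1.Rep_bit1[of x] by simp
  then have "Rep_bit1 x \<in> {0,1,2,3,4,5,6}"
    by auto
  ultimately show ?thesis
    by auto
qed

lemma UNIV_Z7: "(UNIV :: 7 set) = {0, 1, 2, 3, 4, 5, 6}"
  using exhaust_Z7 by auto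

lemma sum_Z7: "(\<Sum>x\<in>(UNIV::7 set). f x) = f 0 + f 1 + f 2 + f 3 + f 4 + f 5 + f (6::7)"
  for f :: "7 \<Rightarrow> 'a::comm_monoid_add"
  unfolding UNIV_Z7 by (simp add: add.assoc)

lemma prod_Z7: "(\<Prod>x\<in>(UNIV::7 set). f x) = f 0 * f 1 * f 2 * f 3 * f 4 * f 5 * f (6::7)"
  for f :: "7 \<Rightarrow> 'a::comm_monoid_mult"
  unfolding UNIV_Z7 by (simp add: mult.assoc)

lemma prod_nonzero_Z7: "(\<Prod>x\<in>-{0::7}. f x) = f 1 * f 2 * f 3 * f 4 * f 5 * f (6::7)"
  for f :: "7 \<Rightarrow> 'a::comm_monoid_mult"
proof -
  have "-{0::7} = {1, 2, 3, 4, 5, 6}"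
    using UNIV_Z7 by auto
  then show ?thesis
    by (simp add: mult.assoc)
qed

lemma forall_Z7: "(\<forall>x::7. P x) \<longleftrightarrow> P 0 \<and> P 1 \<and> P 2 \<and> P 3 \<and> P 4 \<and> P 5 \<and> P 6"
  using exhaust_Z7 by metis

lemma Rep_of_int_Z7: "Rep_bit1 (of_int n :: 7) = n mod 7"
  by (simp only: bit1.of_int_eq bit1.Rep_Abs_mod) simp

lemma of_int_Z7_eq_0_iff: "(of_int n :: 7) = 0 \<longleftrightarrow> 7 dvd n"
  by (simp add: bit1.Rep_inject_sym Rep_of_int_Z7 bit1.Rep_0 dvd_eq_mod_eq_0)

text \<open>The premise makes this terminate as a rewrite rule: only numerals not yet reduced modulo
  7 are rewritten.\<close>

lemma numeral_Z7: "(numeral w :: 7) = of_int (numeral w mod 7)" if "7 \<le> (numeral w :: int)"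
proof -
  have "of_int (numeral w - numeral w mod 7) = (0::7)"
    unfolding of_int_Z7_eq_0_iff by (rule dvd_minus_mod)
  then show ?thesis
    by (simp only: of_int_diff of_int_numeral right_minus_eq)
qed

lemma neg_numeral_Z7:
  "(- 1 :: 7) = 6" "(- 2 :: 7) = 5" "(- 3 :: 7) = 4" "(- 4 :: 7) = 3" "(- 5 :: 7) = 2" "(- 6 :: 7) = 1"
  by simp_all

lemma fermat_Z7: "x ^ 6 = 1" if "x \<noteq> 0" for x :: 7
  using that exhaust_Z7[of x] by (auto simp: power_numeral_reduce)

lemma power_6_Z7: "x ^ 6 = (if x = 0 then 0 else 1)" for x :: 7
  using fermat_Z7 by auto

text \<open>The sixth power is multiplicative and, being 0 or 1, detects zero.\<close>

lemma mult_eq_0_Z7: "x * y = 0 \<longleftrightarrow> x = 0 \<or> y = 0" for x y :: 7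
proof
  assume "x * y = 0"
  then have "x ^ 6 * y ^ 6 = 0"
    by (metis power_mult_distrib zero_eq_power2 power_0_left zero_neq_numeral)
  then show "x = 0 \<or> y = 0"
    by (auto simp: power_6_Z7 split: if_splits)
qed auto

lemma power_eq_0_Z7: "x ^ n = 0 \<longleftrightarrow> x = 0 \<and> n > 0" for x :: 7
  by (induction n) (auto simp: mult_eq_0_Z7)

text \<open>For \<open>k = 0\<close> the convention \<open>0 ^ 0 = 1\<close> makes the sum 7. At
  \<open>k = 6\<close> the sum would be 6; this is the source of every bound \<open>k < 6\<close> on
  moments.\<close>

lemma power_sum_Z7:
  "(\<Sum>x\<in>(UNIV::7 set). x ^ k) = 0" if "k < 6"
proof -
  have "k = 0 \<or> k = 1 \<or> k = 2 \<or> k = 3 \<or> k = 4 \<or> k = 5"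
    using that by auto
  then show ?thesis
    unfolding sum_Z7 by (auto simp: power_numeral_reduce)
qed

subsection \<open>Characters of the cyclic group of order 7\<close>

definition chi :: "7 \<Rightarrow> complex"
  where "chi x = cis (2 * pi * real_of_int (Rep_bit1 x) / 7)"

lemma chi_of_int: "chi (of_int n) = cis (2 * pi * real_of_int n / 7)"
proof -
  have "n = n mod 7 + 7 * (n div 7)" by simp
  then have "real_of_int n = real_of_int (n mod 7) + 7 * real_of_int (n div 7)"
    by (metis of_int_add of_int_mult of_int_numeral)
  then have eq: "2 * pi * real_of_int n / 7
    = 2 * pi * real_of_int (n mod 7) / 7 + 2 * pi * of_int (n div 7)"
    by (simp add: field_simps)
  have "cis (2 * pi * real_of_int n / 7) = cis (2 * pi * real_of_int (n mod 7) / 7)"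
    unfolding eq cis_mult[symmetric] by simp
  then show ?thesis
    by (simp add: chi_def Rep_of_int_Z7)
qed

lemma of_int_Rep_Z7: "of_int (Rep_bit1 x) = (x::7)"
  using bit1.Rep_mod[of x] by (simp add: bit1.of_int_eq bit1.Rep_bit1_inverse)

lemma chi_0 [simp]: "chi 0 = 1"
  by (simp add: chi_def bit1.Rep_0)

lemma chi_add: "chi (x + y) = chi x * chi y"
proof -
  have "chi (of_int (Rep_bit1 x + Rep_bit1 y)) = chi x * chi y"
    unfolding chi_of_int by (simp add: chi_def cis_mult add_divide_distrib distrib_left)
  then show ?thesis
    by (simp add: of_int_Rep_Z7)
qed

lemma norm_chi [simp]: "cmod (chi x) = 1"
  by (simp add: chi_def)

lemma chi_nonzero [simp]: "chi x \<noteq> 0"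
  by (simp add: chi_def)

lemma chi_minus: "chi (- x) = inverse (chi x)"
  using chi_add[of x "-x"] by (simp add: field_simps)

lemma cnj_chi: "cnj (chi x) = chi (- x)"
  by (simp add: chi_minus) (simp add: chi_def cis_cnj)

lemma chi_eq_1_iff: "chi x = 1 \<longleftrightarrow> x = 0"
proof
  assume "chi x = 1"
  then have "cos (2 * pi * real_of_int (Rep_bit1 x) / 7) = 1"
    by (metis chi_def cis.sel(1) one_complex.sel(1))
  then obtain n where "2 * pi * real_of_int (Rep_bit1 x) / 7 = of_int n * 2 * pi"
    using cos_one_2pi_int by auto
  then have "real_of_int (Rep_bit1 x) = of_int (7 * n)"
    by (simp add: field_simps)
  then have "Rep_bit1 x = 7 * n"
    by linarith
  then have "x = of_int (7 * n)"
    using of_int_Rep_Z7 by metis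
  then show "x = 0"
    by (simp add: of_int_Z7_eq_0_iff del: of_int_mult)
qed simp

section \<open>Fourier transform of sequences indexed modulo 7\<close>

lemma sum_shift_Z7: "(\<Sum>x\<in>(UNIV::7 set). f (x + c)) = (\<Sum>x\<in>UNIV. f x)"
  by (rule sum.reindex_bij_witness[of _ "\<lambda>x. x - c" "\<lambda>x. x + c"]) auto

lemma sum_chi: "(\<Sum>x\<in>UNIV. chi (a * x)) = (if a = 0 then 7 else 0)"
proof (cases "a = 0")
  case False
  have "chi a * (\<Sum>x\<in>UNIV. chi (a * x)) = (\<Sum>x\<in>UNIV. chi (a * (x + 1)))"
    by (simp add: sum_distrib_left distrib_left chi_add mult.commute)
  also have "\<dots> = (\<Sum>x\<in>UNIV. chi (a * x))"
    by (rule sum_shift_Z7[where f = "\<lambda>x. chi (a * x)"])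
  finally have "(chi a - 1) * (\<Sum>x\<in>UNIV. chi (a * x)) = 0"
    by (simp add: algebra_simps)
  then show ?thesis
    using False chi_eq_1_iff by auto
qed (simp add: sum_Z7)

text \<open>With \<open>q\<close> read as an element of the group ring of the cyclic group, this is
  its value at \<open>\<omega>^a\<close>: the augmentation for \<open>a = 0\<close>, and the
  conjugates in \<open>Z[\<omega>]\<close> for the other \<open>a\<close>.\<close>

definition ev :: "(7 \<Rightarrow> int) \<Rightarrow> 7 \<Rightarrow> complex"
  where "ev q a = (\<Sum>x\<in>UNIV. of_int (q x) * chi (a * x))"

lemma ev_0: "ev q 0 = of_int (\<Sum>x\<in>UNIV. q x)"
  by (simp add: ev_def)

lemma ev_add: "ev (\<lambda>x. q x + r x) a = ev q a + ev r a"
  by (simp add: ev_def algebra_simps sum.distrib)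

lemma ev_diff: "ev (\<lambda>x. q x - r x) a = ev q a - ev r a"
  by (simp add: ev_def algebra_simps sum_subtractf)

lemma ev_scale: "ev (\<lambda>x. c * q x) a = of_int c * ev q a"
  by (simp add: ev_def algebra_simps sum_distrib_left)

lemma ev_const: "ev (\<lambda>x. c) a = (if a = 0 then 7 * of_int c else 0)"
  using sum_chi[of a] by (simp add: ev_def flip: sum_distrib_left)

lemma ev_shift: "ev (\<lambda>x. q (x - j)) a = chi (a * j) * ev q a"
proof -
  have "ev (\<lambda>x. q (x - j)) a = (\<Sum>x\<in>UNIV. of_int (q (x + j - j)) * chi (a * (x + j)))"
    unfolding ev_def by (rule sum_shift_Z7[symmetric])
  then show ?thesis
    by (simp add: ev_def distrib_left chi_add sum_distrib_left algebra_simps)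
qed

lemma ev_uminus: "ev (\<lambda>x. q (- x)) a = ev q (- a)"
  unfolding ev_def by (rule sum.reindex_bij_witness[of _ uminus uminus]) auto

lemma cnj_ev: "cnj (ev q a) = ev q (- a)"
  by (simp add: ev_def cnj_chi)

lemma fourier_inversion_complex:
  "(\<Sum>a\<in>UNIV. (\<Sum>x\<in>UNIV. f x * chi (a * x)) * chi (- (a * z))) = 7 * f z"
proof -
  have "(\<Sum>a\<in>UNIV. (\<Sum>x\<in>UNIV. f x * chi (a * x)) * chi (- (a * z)))
    = (\<Sum>a\<in>UNIV. \<Sum>x\<in>UNIV. f x * chi ((x - z) * a))"
    unfolding sum_distrib_right
    by (intro sum.cong) (auto simp: chi_add[symmetric] algebra_simps)
  also have "\<dots> = (\<Sum>x\<in>UNIV. f x * (\<Sum>a\<in>UNIV. chi ((x - z) * a)))"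
    by (subst sum.swap) (simp add: sum_distrib_left)
  also have "\<dots> = (\<Sum>x\<in>UNIV. if x = z then 7 * f z else 0)"
    unfolding sum_chi by (intro sum.cong) auto
  finally show ?thesis
    by simp
qed

lemma fourier_inversion: "(\<Sum>a\<in>UNIV. ev q a * chi (- (a * z))) = 7 * of_int (q z)"
  unfolding ev_def by (rule fourier_inversion_complex)

text \<open>Inversion leaves only the term of the trivial character, so the kernel of the map to
  \<open>Z[\<omega>]\<close> consists of constants.\<close>

lemma ev_eq_0_imp_const:
  assumes "\<And>a. a \<noteq> 0 \<Longrightarrow> ev q a = 0"
  shows "q x = q y"
proof -
  have "7 * complex_of_int (q z) = ev q 0" for z
  proof -
    have "7 * complex_of_int (q z) = (\<Sum>a\<in>(UNIV::7 set). if a = 0 then ev q 0 else 0)"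
      unfolding fourier_inversion[symmetric] by (intro sum.cong) (auto simp: assms)
    then show ?thesis by simp
  qed
  then show ?thesis
    by (metis mult_cancel_left of_int_eq_iff zero_neq_numeral)
qed

definition conv :: "(7 \<Rightarrow> int) \<Rightarrow> (7 \<Rightarrow> int) \<Rightarrow> 7 \<Rightarrow> int"
  where "conv q r z = (\<Sum>x\<in>UNIV. q x * r (z - x))"

lemma ev_conv: "ev (conv q r) a = ev q a * ev r a"
proof -
  have "ev (conv q r) a = (\<Sum>x\<in>UNIV. \<Sum>z\<in>UNIV. of_int (q x) * (of_int (r (z - x)) * chi (a * z)))"
    unfolding ev_def conv_def by (simp add: sum_distrib_right mult.assoc) (rule sum.swap)
  also have "\<dots> = (\<Sum>x\<in>UNIV. of_int (q x) * ev (\<lambda>z. r (z - x)) a)"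
    by (simp add: ev_def sum_distrib_left)
  also have "\<dots> = ev q a * ev r a"
    by (simp add: ev_shift) (simp add: ev_def sum_distrib_right algebra_simps)
  finally show ?thesis .
qed

lemma ev_delta: "ev (\<lambda>x. if x = j then 1 else 0) a = chi (a * j)"
  by (simp add: ev_def if_distrib[of of_int] if_distrib[of "\<lambda>t. t * _"] cong: if_cong)

lemma ev_eq_imp_eq:
  assumes "\<And>a. ev q a = ev r a"
  shows "q z = r z"
proof -
  have "7 * complex_of_int (q z) = 7 * of_int (r z)"
    unfolding fourier_inversion[symmetric] by (simp add: assms)
  then show ?thesis by simp
qed

text \<open>The substitution of \<open>\<omega>^c\<close> for \<omega> is a Galois conjugation; on
  coefficients it multiplies the index by the inverse \<open>d\<close> of \<open>c\<close>.\<close>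

lemma ev_mult_arg:
  assumes "c * d = 1"
  shows "ev (\<lambda>x. q (d * x)) a = ev q (c * a)"
  unfolding ev_def
proof (rule sum.reindex_bij_witness[of _ "\<lambda>x. c * x" "\<lambda>x. d * x"])
  fix x :: 7
  have "d * (c * x) = (c * d) * x" "c * (d * x) = (c * d) * x"
    by (simp_all only: ac_simps)
  with assms show *: "d * (c * x) = x" "c * (d * x) = x"
    by simp_all
  have "c * a * (d * x) = a * (c * (d * x))"
    by (simp only: ac_simps)
  then show "of_int (q (d * x)) * chi (c * a * (d * x)) = of_int (q (d * x)) * chi (a * x)"
    by (simp add: *)
qed auto

subsection \<open>Norms from the seventh cyclotomic field\<close>

text \<open>For \<open>\<alpha> = q(\<omega>)\<close> these are the coefficients of \<open>q(x) q(x\<^sup>2) q(x\<^sup>4)\<close>, whose value at \<open>\<omega>\<close> is the norm of \<open>\<alpha>\<close>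
  to the field of \<open>\<surd>(-7)\<close>; the last index is the solution \<open>l\<close> of \<open>i + 2 j + 4 l = k\<close>.\<close>

definition half_norm :: "(7 \<Rightarrow> int) \<Rightarrow> 7 \<Rightarrow> int"
  where "half_norm q k = (\<Sum>i\<in>UNIV. \<Sum>j\<in>UNIV. q i * q j * q (2 * (k - i - 2 * j)))"

lemma sum_half_norm:
  fixes f :: "7 \<Rightarrow> 'a::comm_ring_1"
  shows "(\<Sum>k\<in>UNIV. of_int (half_norm q k) * f k) =
    (\<Sum>i\<in>UNIV. \<Sum>j\<in>UNIV. \<Sum>l\<in>UNIV. of_int (q i) * of_int (q j) * of_int (q l) * f (i + 2 * j + 4 * l))"
proof -
  have inner: "(\<Sum>k\<in>UNIV. of_int (q i) * of_int (q j) * of_int (q (2 * (k - i - 2 * j))) * f k) =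
    (\<Sum>l\<in>UNIV. of_int (q i) * of_int (q j) * of_int (q l) * f (i + 2 * j + 4 * l))" for i j
  proof (rule sum.reindex_bij_witness[of _ "\<lambda>l. i + 2 * j + 4 * l" "\<lambda>k. 2 * (k - i - 2 * j)"])
    show eq: "i + 2 * j + 4 * (2 * (a - i - 2 * j)) = a" "2 * (i + 2 * j + 4 * a - i - 2 * j) = a" for a
      by (simp_all add: algebra_simps numeral_Z7)
    show "of_int (q i) * of_int (q j) * of_int (q (2 * (a - i - 2 * j))) * f (i + 2 * j
      + 4 * (2 * (a - i - 2 * j))) =
      of_int (q i) * of_int (q j) * of_int (q (2 * (a - i - 2 * j))) * f a" for a
      by (simp only: eq)
  qed auto
  have "(\<Sum>k\<in>UNIV. of_int (half_norm q k) * f k) =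
    (\<Sum>i\<in>UNIV. \<Sum>j\<in>UNIV. \<Sum>k\<in>UNIV. of_int (q i) * of_int (q j) * of_int (q (2 * (k - i - 2 * j))) * f k)"
    unfolding half_norm_def of_int_sum sum_distrib_right of_int_mult
    by (subst sum.swap) (subst (2) sum.swap, rule refl)
  then show ?thesis
    unfolding inner .
qed

lemma triple_sum_product:
  fixes f g h :: "7 \<Rightarrow> 'a::comm_ring_1"
  shows "(\<Sum>i\<in>UNIV. \<Sum>j\<in>UNIV. \<Sum>l\<in>UNIV. f i * g j * h l) = sum f UNIV * sum g UNIV * sum h UNIV"
  by (simp flip: sum_distrib_left sum_distrib_right)

lemma ev_half_norm: "ev (half_norm q) a = ev q a * ev q (2 * a) * ev q (4 * a)"
proof -
  have "ev (half_norm q) a = (\<Sum>i\<in>UNIV. \<Sum>j\<in>UNIV. \<Sum>l\<in>UNIV.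
     (of_int (q i) * chi (a * i)) * (of_int (q j) * chi (2 * a * j)) * (of_int (q l) * chi (4 * a * l)))"
    unfolding ev_def sum_half_norm[of q "\<lambda>k. chi (a * k)"]
    by (intro sum.cong refl) (simp add: distrib_left chi_add mult.commute mult.left_commute mult.assoc)
  then show ?thesis
    by (simp only: triple_sum_product ev_def)
qed

text \<open>Multiplication by 2 permutes 1, 2, 4 and hence the three factors of the half norm. So
  its coefficients are constant on {1, 2, 4} and on {3, 5, 6}.\<close>

lemma half_norm_double: "half_norm q (2 * k) = half_norm q k"
proof (rule ev_eq_imp_eq[of "\<lambda>k. half_norm q (2 * k)"])
  fix a
  have "ev (\<lambda>k. half_norm q (2 * k)) a = ev (half_norm q) (4 * a)"
    by (rule ev_mult_arg) simp
  then show "ev (\<lambda>k. half_norm q (2 * k)) a = ev (half_norm q) a"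
    by (simp add: ev_half_norm numeral_Z7 mult.assoc[symmetric])
qed

lemma half_norm_orbits: "half_norm q 2 = half_norm q 1" "half_norm q 4 = half_norm q 1"
    "half_norm q 6 = half_norm q 3" "half_norm q 5 = half_norm q 3"
  using half_norm_double[of q 1] half_norm_double[of q 2] half_norm_double[of q 3] half_norm_double[of q
    6] by (simp_all add: numeral_Z7)

text \<open>The half norm takes the value \<open>X + Y * theta\<close>: subtracting the coefficient
  at 3 everywhere changes no value at a nontrivial character.\<close>

definition norm_X :: "(7 \<Rightarrow> int) \<Rightarrow> int" where "norm_X q = half_norm q 0 - half_norm q 3"
definition norm_Y :: "(7 \<Rightarrow> int) \<Rightarrow> int" where "norm_Y q = half_norm q 1 - half_norm q 3"

text \<open>The norm form of \<open>Z[theta]\<close>: the two conjugates of \<open>theta\<close>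
  have sum -1 and product 2 (\<open>theta_1_3\<close>).\<close>

definition cyc_norm :: "(7 \<Rightarrow> int) \<Rightarrow> int"
  where "cyc_norm q = (norm_X q)\<^sup>2 - norm_X q * norm_Y q + 2 * (norm_Y q)\<^sup>2"

definition theta :: "7 \<Rightarrow> complex"
  where "theta a = chi a + chi (2 * a) + chi (4 * a)"

lemma ev_half_norm_theta:
  assumes "a \<noteq> 0"
  shows "ev (half_norm q) a = of_int (norm_X q) + of_int (norm_Y q) * theta a"
proof -
  have "ev (\<lambda>x. half_norm q x - half_norm q 3) a = of_int (norm_X q) + of_int (norm_Y q) * theta a"
    unfolding ev_def sum_Z7
    by (simp add: half_norm_orbits theta_def norm_X_def norm_Y_def algebra_simps numeral_Z7)
  moreover have "ev (\<lambda>x. half_norm q 3) a = 0"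
    using assms by (simp add: ev_const)
  ultimately show ?thesis
    using ev_diff[of "half_norm q" "\<lambda>_. half_norm q 3" a] by simp
qed

lemma sum_chi_powers: "chi 1 + chi 2 + chi 3 + chi 4 + chi 5 + chi 6 = - 1"
proof -
  have "1 + (chi 1 + chi 2 + chi 3 + chi 4 + chi 5 + chi 6) = 0"
    using sum_chi[of 1] by (simp add: sum_Z7 add.assoc)
  then show ?thesis
    by (metis add.inverse_inverse add_eq_0_iff)
qed

lemma theta_1_3: "theta 1 + theta 3 = - 1" "theta 1 * theta 3 = 2"
  using sum_chi_powers
  by (simp_all add: theta_def algebra_simps numeral_Z7 flip: chi_add)

lemma cyc_norm_eq_prod: "of_int (cyc_norm q) = (\<Prod>a\<in>-{0}. ev q a)"
proof -
  have "(\<Prod>a\<in>-{0}. ev q a) = ev (half_norm q) 1 * ev (half_norm q) 3"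
    by (simp add: prod_nonzero_Z7 ev_half_norm numeral_Z7)
  also have "\<dots> = (of_int (norm_X q) + of_int (norm_Y q) * theta 1) * (of_int (norm_X q)
    + of_int (norm_Y q) * theta 3)"
    by (simp add: ev_half_norm_theta)
  also have "\<dots> = (of_int (norm_X q))\<^sup>2 + of_int (norm_X q) * of_int (norm_Y q) * (theta 1 + theta 3)
      + (of_int (norm_Y q))\<^sup>2 * (theta 1 * theta 3)"
    by (simp add: algebra_simps power2_eq_square)
  also have "\<dots> = of_int (cyc_norm q)"
    by (simp add: theta_1_3 cyc_norm_def)
  finally show ?thesis by simp
qed

lemma four_cyc_norm: "4 * cyc_norm q = (2 * norm_X q - norm_Y q)\<^sup>2 + 7 * (norm_Y q)\<^sup>2"
  by (simp add: cyc_norm_def power2_eq_square algebra_simps)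

lemma cyc_norm_nonneg: "cyc_norm q \<ge> 0"
proof -
  have "0 \<le> 4 * cyc_norm q"
    unfolding four_cyc_norm by simp
  then show ?thesis by simp
qed

lemma cyc_norm_cong:
  assumes "\<And>a. a \<noteq> 0 \<Longrightarrow> ev q a = ev r a"
  shows "cyc_norm q = cyc_norm r"
proof -
  have "complex_of_int (cyc_norm q) = of_int (cyc_norm r)"
    unfolding cyc_norm_eq_prod by (intro prod.cong) (auto simp: assms)
  then show ?thesis by simp
qed

lemma cyc_norm_mult:
  assumes "\<And>a. a \<noteq> 0 \<Longrightarrow> ev q a = ev r a * ev s a"
  shows "cyc_norm q = cyc_norm r * cyc_norm s"
proof -
  have "complex_of_int (cyc_norm q) = of_int (cyc_norm r * cyc_norm s)"
    unfolding cyc_norm_eq_prod of_int_mult prod.distrib[symmetric] by (intro prod.cong)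
      (auto simp: assms)
  then show ?thesis by (simp only: of_int_eq_iff)
qed

text \<open>\<open>B0\<close> to \<open>B6\<close> are the coefficients of
  \<open>q(x^2) q(x^4)\<close>; \<open>t0\<close>, \<open>t1\<close>, \<open>t3\<close> are those of
  the half norm, whose other coefficients repeat these. The closed form serves to evaluate norms of
  concrete witnesses.\<close>

definition cyc_norm_explicit :: "int \<Rightarrow> int \<Rightarrow> int \<Rightarrow> int \<Rightarrow> int \<Rightarrow> int \<Rightarrow> int \<Rightarrow> int"
  where "cyc_norm_explicit a b c d e f g = (let
    B0 = a * a + b * d + c * g + d * c + e * f + f * b + g * e;
    B1 = a * c + b * f + c * b + d * e + e * a + f * d + g * g;
    B2 = a * e + b * a + c * d + d * g + e * c + f * f + g * b;
    B3 = a * g + b * c + c * f + d * b + e * e + f * a + g * d;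
    B4 = a * b + b * e + c * a + d * d + e * g + f * c + g * f;
    B5 = a * d + b * g + c * c + d * f + e * b + f * e + g * a;
    B6 = a * f + b * b + c * e + d * a + e * d + f * g + g * c;
    t0 = a * B0 + b * B6 + c * B5 + d * B4 + e * B3 + f * B2 + g * B1;
    t1 = a * B1 + b * B0 + c * B6 + d * B5 + e * B4 + f * B3 + g * B2;
    t3 = a * B3 + b * B2 + c * B1 + d * B0 + e * B6 + f * B5 + g * B4;
    X = t0 - t3; Y = t1 - t3
  in X\<^sup>2 - X * Y + 2 * Y\<^sup>2)"

lemma cyc_norm_eq_explicit: "cyc_norm q = cyc_norm_explicit (q 0) (q 1) (q 2) (q 3) (q 4) (q 5) (q 6)"
proof -
  define B where "B m = (\<Sum>j\<in>UNIV. q j * q (2 * (m - 2 * j)))" for m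
  have half_norm: "half_norm q k = (\<Sum>i\<in>UNIV. q i * B (k - i))" for k
    by (simp add: half_norm_def B_def sum_distrib_left mult.assoc)
  show ?thesis
    unfolding cyc_norm_def norm_X_def norm_Y_def half_norm cyc_norm_explicit_def Let_def
    by (simp add: sum_Z7 numeral_Z7 neg_numeral_Z7) (simp add: B_def sum_Z7 numeral_Z7 neg_numeral_Z7)
qed

section \<open>Moments and norms modulo 7\<close>

definition moment :: "nat \<Rightarrow> (7 \<Rightarrow> int) \<Rightarrow> 7"
  where "moment k q = (\<Sum>x\<in>UNIV. of_int (q x) * x ^ k)"

lemma moment_half_norm_0: "moment 0 (half_norm q) = moment 0 q ^ 3"
  using sum_half_norm[of q "\<lambda>_. 1 :: 7"]
  by (simp only: moment_def triple_sum_product mult_1_right power_0 power3_eq_cube)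

text \<open>Modulo 7 the weights 1, 2, 4 sum to 0, their squares to 0 and their cubes to 3. So only
  cumulants of order three survive, and the result is three times the third cumulant of
  \<open>q\<close> with denominators cleared.\<close>

lemma moment_half_norm_3:
  "moment 3 (half_norm q) = 3 * moment 0 q ^ 2 * moment 3 q + 5 * moment 0 q * moment 1 q * moment 2 q
    + 6 * moment 1 q ^ 3"
proof -
  let ?s = "\<lambda>f g h. (\<Sum>i\<in>UNIV. \<Sum>j\<in>UNIV. \<Sum>l\<in>UNIV. (of_int (q i) * i ^ f) * (of_int (q j) * j ^ g) * (of_int
    (q l) * l ^ h)) :: 7"
  have s: "?s f g h = moment f q * moment g q * moment h q" for f g h
    unfolding triple_sum_product moment_def ..
  have "moment 3 (half_norm q) = (\<Sum>i\<in>UNIV. \<Sum>j\<in>UNIV. \<Sum>l\<in>UNIV.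
    of_int (q i) * of_int (q j) * of_int (q l) * (i + 2 * j + 4 * l) ^ 3)"
    unfolding moment_def by (rule sum_half_norm)
  also have "\<dots> = ?s 3 0 0 + ?s 0 3 0 + ?s 0 0 3 + 6 * ?s 2 1 0 + 5 * ?s 2 0 1 + 5 * ?s 1 2 0
     + 6 * ?s 1 0 2 + 6 * ?s 0 2 1 + 5 * ?s 0 1 2 + 6 * ?s 1 1 1"
    unfolding sum_distrib_left sum.distrib[symmetric]
    by (intro sum.cong refl) (simp add: algebra_simps power2_eq_square power3_eq_cube numeral_Z7)
  finally show ?thesis
    unfolding s by (simp add: algebra_simps power2_eq_square power3_eq_cube numeral_Z7)
qed

text \<open>Modulo the prime above 7, \<omega> becomes 1 and \<open>theta\<close> becomes 3.\<close>

lemma norm_X_norm_Y_mod7: "of_int (norm_X q) + 3 * of_int (norm_Y q) = moment 0 q ^ 3"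
  unfolding moment_half_norm_0[symmetric]
  by (simp add: moment_def sum_Z7 half_norm_orbits norm_X_def norm_Y_def algebra_simps numeral_Z7)

text \<open>\<open>x ^ 3\<close> is the quadratic character modulo 7, so the third moment of the
  half norm is \<open>3 * Y\<close>; 5 is the inverse of 3.\<close>

lemma norm_Y_mod7: "of_int (norm_Y q)
    = moment 0 q ^ 2 * moment 3 q + 4 * moment 0 q * moment 1 q * moment 2 q + 2 * moment 1 q ^ 3"
proof -
  have "3 * of_int (norm_Y q) = moment 3 (half_norm q)"
    by (simp add: moment_def sum_Z7 half_norm_orbits norm_Y_def algebra_simps numeral_Z7)
  then have "5 * (3 * of_int (norm_Y q)) = 5 * moment 3 (half_norm q)"
    by simp
  then show ?thesis
    by (simp add: moment_half_norm_3 algebra_simps numeral_Z7)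
qed

text \<open>Since 7 ramifies, the norm form becomes the square of \<open>X + 3 * Y\<close> modulo
  7.\<close>

lemma cyc_norm_mod7: "of_int (cyc_norm q) = moment 0 q ^ 6"
proof -
  have "of_int (cyc_norm q) = (of_int (norm_X q) + 3 * of_int (norm_Y q) :: 7) ^ 2"
    by (simp add: cyc_norm_def power2_eq_square algebra_simps numeral_Z7)
  also have "\<dots> = moment 0 q ^ 6"
    unfolding norm_X_norm_Y_mod7 by (simp flip: power_mult)
  finally show ?thesis .
qed

subsection \<open>Factorization of the group determinant\<close>

definition fourier :: "(int, C7xC7) vec \<Rightarrow> 7 \<Rightarrow> 7 \<Rightarrow> complex"
  where "fourier v c d = (\<Sum>(i, j)\<in>UNIV. of_int (v $ (i, j)) * chi (c * i + d * j))"

definition pair_chi :: "C7xC7 \<Rightarrow> C7xC7 \<Rightarrow> complex"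
  where "pair_chi g k = chi (fst k * fst g + snd k * snd g)"

lemma pair_chi_add: "pair_chi (g + h) k = pair_chi g k * pair_chi h k"
  by (simp add: pair_chi_def algebra_simps flip: chi_add)

lemma pair_chi_diff: "pair_chi (g - h) k = pair_chi g k * pair_chi (- h) k"
  using pair_chi_add[of g "- h" k] by simp

lemma pair_chi_minus: "pair_chi (- g) k = pair_chi g (- k)"
  by (simp add: pair_chi_def)

lemma fourier_alt: "fourier v c d = (\<Sum>g\<in>UNIV. of_int (v $ g) * pair_chi g (c, d))"
  by (simp add: fourier_def pair_chi_def case_prod_unfold)

lemma det_of_int: "det (\<chi> i j. of_int (M $ i $ j)) = (of_int (det M) :: 'a::comm_ring_1)"
  by (simp add: det_def)

lemma sum_pair_chi: "(\<Sum>k\<in>UNIV. pair_chi g k) = (if g = 0 then 49 else 0)"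
proof -
  have "(\<Sum>k\<in>UNIV. pair_chi g k) = (\<Sum>(c, d)\<in>UNIV \<times> UNIV. chi (fst g * c) * chi (snd g * d))"
    by (intro sum.cong) (auto simp: pair_chi_def chi_add[symmetric] mult.commute)
  also have "\<dots> = (\<Sum>c\<in>UNIV. chi (fst g * c)) * (\<Sum>d\<in>UNIV. chi (snd g * d))"
    by (simp add: sum_product sum.cartesian_product)
  finally show ?thesis
    by (auto simp: sum_chi prod_eq_iff)
qed

text \<open>The character matrix \<open>W\<close> diagonalizes the group matrix and is invertible by
  orthogonality. The eigenvalues involve \<open>pair_chi (- u)\<close>, whence the final reindexing
  by negation.\<close>

lemma group_det_eq_prod_fourier: "of_int (group_det v) = (\<Prod>(c, d)\<in>UNIV. fourier v c d)"
proof -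
  define M :: "complex^C7xC7^C7xC7" where "M = (\<chi> g h. of_int (v $ (g - h)))"
  define W :: "complex^C7xC7^C7xC7" where "W = (\<chi> g k. pair_chi g k)"
  define W' :: "complex^C7xC7^C7xC7" where "W' = (\<chi> k g. pair_chi (- g) k)"
  define D :: "complex^C7xC7^C7xC7" where "D = (\<chi> k l. if k
    = l then (\<Sum>u\<in>UNIV. of_int (v $ u) * pair_chi (- u) k) else 0)"
  define E :: "complex^C7xC7^C7xC7" where "E = (\<chi> g h. if g = h then 49 else 0)"
  have "(M ** W) $ g $ k = (W ** D) $ g $ k" for g k
  proof -
    have "(M ** W) $ g $ k = (\<Sum>h\<in>UNIV. of_int (v $ (g - h)) * pair_chi h k)"
      by (simp add: M_def W_def matrix_matrix_mult_def)
    also have "\<dots> = (\<Sum>u\<in>UNIV. of_int (v $ u) * pair_chi (g - u) k)"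
      by (rule sum.reindex_bij_witness[of _ "\<lambda>u. g - u" "\<lambda>h. g - h"]) auto
    also have "\<dots> = (W ** D) $ g $ k"
      by (simp add: W_def D_def matrix_matrix_mult_def if_distrib[of "\<lambda>t. _ * t"] sum_distrib_left
          pair_chi_diff mult.left_commute cong: if_cong)
    finally show ?thesis .
  qed
  then have MW: "M ** W = W ** D"
    by (simp add: vec_eq_iff)
  have "(W ** W') $ g $ h = E $ g $ h" for g h
    by (simp add: W_def W'_def E_def matrix_matrix_mult_def sum_pair_chi flip: pair_chi_diff)
  then have "W ** W' = E"
    by (simp add: vec_eq_iff)
  then have "det W * det W' = det E"
    by (metis det_mul)
  also have "det E = (\<Prod>g\<in>UNIV. E $ g $ g)"
    by (rule det_diagonal) (simp add: E_def)
  also have "\<dots> \<noteq> 0"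
    by (simp add: E_def)
  finally have "det W \<noteq> 0"
    by auto
  moreover have "det M * det W = det W * det D"
    by (metis MW det_mul)
  ultimately have "det M = det D"
    by simp
  also have "det D = (\<Prod>k\<in>UNIV. D $ k $ k)"
    by (rule det_diagonal) (simp add: D_def)
  also have "\<dots> = (\<Prod>(c, d)\<in>UNIV. fourier v c d)"
  proof (rule prod.reindex_bij_witness[of _ uminus uminus])
    fix k :: C7xC7
    show "(case - k of (c, d) \<Rightarrow> fourier v c d) = D $ k $ k"
      by (cases k) (simp add: fourier_alt D_def pair_chi_minus)
  qed auto
  finally show ?thesis
    unfolding M_def group_det_def by (simp flip: det_of_int)
qed

text \<open>Coefficients of \<open>F(x, x\<^sup>b)\<close> and of \<open>F(1, y)\<close>.\<close>

definition push_line :: "(int, C7xC7) vec \<Rightarrow> 7 \<Rightarrow> 7 \<Rightarrow> int"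
  where "push_line v b n = (\<Sum>j\<in>UNIV. v $ (n - b * j, j))"

definition push_snd :: "(int, C7xC7) vec \<Rightarrow> 7 \<Rightarrow> int"
  where "push_snd v n = (\<Sum>i\<in>UNIV. v $ (i, n))"

lemma sum_push_line:
  fixes f :: "7 \<Rightarrow> 'a::comm_ring_1"
  shows "(\<Sum>n\<in>UNIV. of_int (push_line v b n) * f n) = (\<Sum>(i, j)\<in>UNIV. of_int (v $ (i, j)) * f (i + b * j))"
proof -
  have "(\<Sum>n\<in>UNIV. of_int (push_line v b n) * f n)
    = (\<Sum>j\<in>UNIV. \<Sum>n\<in>UNIV. of_int (v $ (n - b * j, j)) * f n)"
    unfolding push_line_def of_int_sum sum_distrib_right by (rule sum.swap)
  also have "\<dots> = (\<Sum>j\<in>UNIV. (\<Sum>i\<in>UNIV. of_int (v $ (i, j)) * f (i + b * j)))"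
  proof (rule sum.cong[OF refl])
    fix j :: 7
    show "(\<Sum>n\<in>UNIV. of_int (v $ (n - b * j, j)) * f n) = (\<Sum>i\<in>UNIV. of_int (v $ (i, j)) * f (i + b * j))"
      by (rule sum.reindex_bij_witness[of _ "\<lambda>i. i + b * j" "\<lambda>n. n - b * j"]) auto
  qed
  also have "\<dots> = (\<Sum>(i, j)\<in>UNIV \<times> UNIV. of_int (v $ (i, j)) * f (i + b * j))"
    by (subst sum.swap) (rule sum.cartesian_product)
  finally show ?thesis by simp
qed

lemma sum_push_snd:
  fixes f :: "7 \<Rightarrow> 'a::comm_ring_1"
  shows "(\<Sum>n\<in>UNIV. of_int (push_snd v n) * f n) = (\<Sum>(i, j)\<in>UNIV. of_int (v $ (i, j)) * f j)"
proof -
  have "(\<Sum>n\<in>UNIV. of_int (push_snd v n) * f n) = (\<Sum>(i, j)\<in>UNIV \<times> UNIV. of_int (v $ (i, j)) * f j)"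
    unfolding push_snd_def of_int_sum sum_distrib_right
    by (subst sum.swap) (rule sum.cartesian_product)
  then show ?thesis by simp
qed

lemma ev_push_line: "ev (push_line v b) a = fourier v a (a * b)"
  unfolding ev_def sum_push_line[of v b "\<lambda>n. chi (a * n)"] fourier_def by
    (simp add: distrib_left mult.assoc)

lemma ev_push_snd: "ev (push_snd v) a = fourier v 0 a"
  unfolding ev_def sum_push_snd[of v "\<lambda>n. chi (a * n)"] fourier_def by simp

text \<open>The nonzero pairs lie on eight lines through the origin: those of slope
  \<open>b\<close>, and \<open>c = 0\<close>. For nonzero \<open>c\<close> the slope is
  \<open>c ^ 5 * d\<close>, as \<open>c ^ 5\<close> inverts \<open>c\<close>.\<close>

lemma prod_lines:
  fixes f :: "7 \<Rightarrow> 7 \<Rightarrow> 'a::comm_monoid_mult"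
  shows "(\<Prod>(c, d)\<in>UNIV. f c d) = f 0 0 * (\<Prod>b\<in>UNIV. \<Prod>a\<in>-{0}. f a (a * b)) * (\<Prod>a\<in>-{0}. f 0 a)"
proof -
  have "(\<Prod>(c, d)\<in>UNIV. f c d) = (\<Prod>c\<in>UNIV. \<Prod>d\<in>UNIV. f c d)"
    by (simp add: prod.cartesian_product)
  also have "\<dots> = (\<Prod>d\<in>UNIV. f 0 d) * (\<Prod>c\<in>-{0}. \<Prod>d\<in>UNIV. f c d)"
    by (subst prod.remove[of _ 0]) (simp_all add: Compl_eq_Diff_UNIV)
  also have "(\<Prod>d\<in>UNIV. f 0 d) = f 0 0 * (\<Prod>a\<in>-{0}. f 0 a)"
    by (subst prod.remove[of _ 0]) (simp_all add: Compl_eq_Diff_UNIV)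
  also have "(\<Prod>c\<in>-{0}. \<Prod>d\<in>UNIV. f c d) = (\<Prod>c\<in>-{0}. \<Prod>b\<in>UNIV. f c (c * b))"
  proof (rule prod.cong[OF refl])
    fix c :: 7
    assume "c \<in> -{0}"
    then have c: "c ^ 5 * c = 1" "c * c ^ 5 = 1"
      using fermat_Z7[of c] by (simp_all add: power_numeral_reduce mult_ac)
    show "(\<Prod>d\<in>UNIV. f c d) = (\<Prod>b\<in>UNIV. f c (c * b))"
      by (rule prod.reindex_bij_witness[of _ "\<lambda>b. c * b" "\<lambda>d. c ^ 5 * d"])
        (simp_all add: mult.assoc[symmetric] c)
  qed
  also have "\<dots> = (\<Prod>b\<in>UNIV. \<Prod>a\<in>-{0}. f a (a * b))"
    by (rule prod.swap)
  finally show ?thesis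
    by (simp add: ac_simps)
qed

lemma group_det_eq:
  "group_det v = (\<Sum>g\<in>UNIV. v $ g) * (\<Prod>b\<in>UNIV. cyc_norm (push_line v b)) * cyc_norm (push_snd v)"
proof -
  have "complex_of_int (group_det v) =
    of_int ((\<Sum>g\<in>UNIV. v $ g) * (\<Prod>b\<in>UNIV. cyc_norm (push_line v b)) * cyc_norm (push_snd v))"
    unfolding group_det_eq_prod_fourier prod_lines of_int_mult of_int_prod cyc_norm_eq_prod ev_push_line
      ev_push_snd
    by (simp add: fourier_def case_prod_unfold)
  then show ?thesis
    by (simp only: of_int_eq_iff)
qed

text \<open>In the notation of the introduction, \<open>A\<close>, \<open>B\<close>,
  \<open>C\<close> are \<open>moment2 v 1 0\<close>, \<open>moment2 v 0 1\<close>,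
  \<open>moment2 v 0 2\<close>.\<close>

definition moment2 :: "(int, C7xC7) vec \<Rightarrow> nat \<Rightarrow> nat \<Rightarrow> 7"
  where "moment2 v k l = (\<Sum>(i, j)\<in>UNIV. of_int (v $ (i, j)) * (i ^ k * j ^ l))"

lemma moment_push_line: "moment k (push_line v b)
    = (\<Sum>(i, j)\<in>UNIV. of_int (v $ (i, j)) * (i + b * j) ^ k)"
  unfolding moment_def by (rule sum_push_line)

lemma moment_push_snd: "moment k (push_snd v) = moment2 v 0 k"
  unfolding moment_def moment2_def sum_push_snd[of v "\<lambda>n. n ^ k"] by simp

lemma moment_push_line_expand:
  "moment 0 (push_line v b) = moment2 v 0 0"
  "moment 1 (push_line v b) = moment2 v 1 0 + b * moment2 v 0 1"
  "moment 2 (push_line v b) = moment2 v 2 0 + 2 * b * moment2 v 1 1 + b ^ 2 * moment2 v 0 2"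
  "moment 3 (push_line v b) = moment2 v 3 0 + 3 * b * moment2 v 2 1 + 3 * b ^ 2 * moment2 v 1 2
    + b ^ 3 * moment2 v 0 3"
  "moment 4 (push_line v b) = moment2 v 4 0 + 4 * b * moment2 v 3 1 + 6 * b ^ 2 * moment2 v 2 2
    + 4 * b ^ 3 * moment2 v 1 3 + b ^ 4 * moment2 v 0 4"
  unfolding moment_push_line moment2_def sum_distrib_left sum.distrib[symmetric]
  by (intro sum.cong refl; simp add: case_prod_unfold algebra_simps power_numeral_reduce numeral_Z7)+

lemma moment2_0_0: "moment2 v 0 0 = of_int (\<Sum>g\<in>UNIV. v $ g)"
  by (simp add: moment2_def case_prod_unfold)

subsection \<open>Division by the prime above 7, and units\<close>

lemma moment_diff: "moment k (\<lambda>x. q x - r x) = moment k q - moment k r"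
  by (simp add: moment_def algebra_simps sum_subtractf)

lemma moment_add: "moment k (\<lambda>x. q x + r x) = moment k q + moment k r"
  by (simp add: moment_def algebra_simps sum.distrib)

lemma moment_scale: "moment k (\<lambda>x. c * q x) = of_int c * moment k q"
  by (simp add: moment_def algebra_simps sum_distrib_left)

lemma moment_const: "k < 6 \<Longrightarrow> moment k (\<lambda>x. c) = 0"
  by (simp add: moment_def power_sum_Z7 flip: sum_distrib_left)

lemma moment_uminus: "moment k (\<lambda>x. q (- x)) = (- 1) ^ k * moment k q"
proof -
  have "moment k (\<lambda>x. q (- x)) = (\<Sum>x\<in>UNIV. of_int (q x) * (- x) ^ k)"
    unfolding moment_def by (rule sum.reindex_bij_witness[of _ uminus uminus]) auto
  also have "\<dots> = (\<Sum>x\<in>UNIV. of_int (q x) * ((- 1) ^ k * x ^ k))"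
    by (intro sum.cong refl) (subst power_minus, rule refl)
  finally show ?thesis
    by (simp add: moment_def sum_distrib_left mult.left_commute)
qed

lemma moment_shift: "moment k (\<lambda>x. q (x - j)) = (\<Sum>x\<in>UNIV. of_int (q x) * (x + j) ^ k)"
  unfolding moment_def by (rule sum.reindex_bij_witness[of _ "\<lambda>x. x + j" "\<lambda>x. x - j"]) auto

lemma moment_shift_expand:
  "moment 0 (\<lambda>x. q (x - j)) = moment 0 q"
  "moment 1 (\<lambda>x. q (x - j)) = moment 1 q + j * moment 0 q"
  "moment 2 (\<lambda>x. q (x - j)) = moment 2 q + 2 * j * moment 1 q + j ^ 2 * moment 0 q"
  "moment 3 (\<lambda>x. q (x - j))
    = moment 3 q + 3 * j * moment 2 q + 3 * j ^ 2 * moment 1 q + j ^ 3 * moment 0 q"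
  "moment 4 (\<lambda>x. q (x - j))
    = moment 4 q + 4 * j * moment 3 q + 6 * j ^ 2 * moment 2 q + 4 * j ^ 3 * moment 1 q
      + j ^ 4 * moment 0 q"
  unfolding moment_shift unfolding moment_def sum_distrib_left sum.distrib[symmetric]
  by (intro sum.cong refl; simp add: algebra_simps power_numeral_reduce)+

text \<open>The difference of \<open>q\<close> and \<open>r\<close> is constant, and constants have
  zero moments below order 6. So these moments belong to the element of \<open>Z[\<omega>]\<close>
  and not just to its chosen coefficients.\<close>

lemma moment_cong:
  assumes "\<And>a. a \<noteq> 0 \<Longrightarrow> ev q a = ev r a" and "k < 6"
  shows "moment k q = moment k r"
proof -
  have "(\<lambda>x. q x - r x) = (\<lambda>x. q 0 - r 0)"
    by (rule ext, rule ev_eq_0_imp_const[of "\<lambda>x. q x - r x"]) (simp add: ev_diff assms)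
  then have "moment k q - moment k r = moment k (\<lambda>x. q 0 - r 0)"
    using moment_diff[of k q r] by simp
  with \<open>k < 6\<close> show ?thesis
    by (simp add: moment_const)
qed

lemma cyc_norm_delta_diff: "cyc_norm (\<lambda>x. (if x = 1 then 1 else 0) - (if x = 0 then 1 else 0)) = 7"
  by (simp add: cyc_norm_eq_explicit) (simp add: cyc_norm_explicit_def)

text \<open>\<open>r\<close> represents \<open>q / (\<omega> - 1)\<close>. The moment identities
  come from expanding \<open>(x + 1) ^ k - x ^ k\<close>.\<close>

definition pi_quotient :: "(7 \<Rightarrow> int) \<Rightarrow> (7 \<Rightarrow> int) \<Rightarrow> bool"
  where "pi_quotient q r \<longleftrightarrow> (\<forall>a. a \<noteq> 0 \<longrightarrow> ev q a = (chi a - 1) * ev r a) \<and>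
    cyc_norm q = 7 * cyc_norm r \<and>
    moment 1 q = moment 0 r \<and>
    moment 2 q = 2 * moment 1 r + moment 0 r \<and>
    moment 3 q = 3 * moment 2 r + 3 * moment 1 r + moment 0 r \<and>
    moment 4 q = 4 * moment 3 r + 6 * moment 2 r + 4 * moment 1 r + moment 0 r"

lemma ex_pi_quotient:
  assumes "moment 0 q = 0"
  shows "\<exists>r. pi_quotient q r"
proof -
  have "of_int (\<Sum>x\<in>UNIV. q x) = (0::7)"
    using assms by (simp add: moment_def)
  then obtain m where m: "(\<Sum>x\<in>UNIV. q x) = 7 * m"
    unfolding of_int_Z7_eq_0_iff by blast
  \<comment> \<open>Subtracting \<open>m\<close> makes the coefficients sum to 0 and changes no
    value at a nontrivial character. Then \<open>r\<close> is minus the partial sums of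
    \<open>p\<close>, with \<open>r 6 = 0\<close>; at 4 and 5 the zero total is used to shorten
    them.\<close>
  define p where "p x = q x - m" for x
  define r where "r x = (if x = 0 then - p 0 else if x = 1 then - p 0 - p 1
    else if x = 2 then - p 0 - p 1 - p 2 else if x = 3 then - p 0 - p 1 - p 2 - p 3
    else if x = 4 then p 5 + p 6 else if x = 5 then p 6 else 0)" for x :: 7
  have "\<forall>x. p x = r (x - 1) - r x"
    using m unfolding forall_Z7 by (simp add: r_def) (simp add: p_def sum_Z7)
  then have p: "p x = r (x - 1) - r x" for x
    by blast
  have ev_p: "ev q a = ev p a" if "a \<noteq> 0" for a
    using that ev_diff[of q "\<lambda>x. m" a] by (simp add: p_def[abs_def] ev_const)
  have ev: "ev q a = (chi a - 1) * ev r a" if "a \<noteq> 0" for a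
    unfolding ev_p[OF that] p[abs_def] by (simp add: ev_diff ev_shift algebra_simps)
  have moment: "moment k q = moment k (\<lambda>x. r (x - 1)) - moment k r" if "k < 6" for k
    using moment_cong[of q p k, OF ev_p that] by (simp add: p[abs_def] moment_diff)
  have "cyc_norm q = 7 * cyc_norm r"
    unfolding cyc_norm_delta_diff[symmetric]
    by (rule cyc_norm_mult) (simp add: ev ev_diff ev_delta)
  moreover have "moment 1 q = moment 0 r" "moment 2 q = 2 * moment 1 r + moment 0 r"
    "moment 3 q = 3 * moment 2 r + 3 * moment 1 r + moment 0 r"
    "moment 4 q = 4 * moment 3 r + 6 * moment 2 r + 4 * moment 1 r + moment 0 r"
    by (simp_all add: moment moment_shift_expand del: One_nat_def)
  ultimately have "pi_quotient q r"
    unfolding pi_quotient_def using ev by blast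
  then show ?thesis
    by (rule exI[where P = "pi_quotient q"])
qed

text \<open>Norm 1 makes the inverse of \<open>r\<close> the product of its other five conjugates.
  So \<open>cnj r / r\<close> is an algebraic integer all of whose conjugates have modulus 1, hence
  a root of unity.\<close>

lemma unit_conj:
  assumes "cyc_norm r = 1"
  obtains e j where "e = 1 \<or> e = (- 1 :: int)"
    "\<And>a. a \<noteq> 0 \<Longrightarrow> ev r (- a) = of_int e * chi (a * j) * ev r a"
proof -
  \<comment> \<open>A Galois conjugate of \<open>r\<close>: \<open>c ^ 5\<close> is the inverse of
    \<open>c\<close>.\<close>
  define s where "s c x = r (c ^ 5 * x)" for c x :: 7
  have ev_s: "ev (s c) a = ev r (c * a)" if "c \<noteq> 0" for a c
    unfolding s_def[abs_def]
    by (rule ev_mult_arg) (use fermat_Z7[OF that] in \<open>simp add: power_numeral_reduce\<close>)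
  \<comment> \<open>Here \<open>w\<close> represents \<open>cnj r / r\<close>. All its conjugates have modulus 1, so Parseval gives
    \<open>7 \<Sum> w\<^sup>2 - (\<Sum> w)\<^sup>2 = 6\<close>, which leaves only \<open>\<plusminus>\<close> a group element plus a constant.\<close>
  define w where "w = conv (\<lambda>x. r (- x)) (conv (s 2) (conv (s 3) (conv (s 4) (conv (s 5) (s 6)))))"
  have w: "ev w a =
      ev r (- a) * (ev r (2 * a) * (ev r (3 * a) * (ev r (4 * a) * (ev r (5 * a) * ev r (6 * a)))))" for a
    by (simp add: w_def ev_conv ev_uminus ev_s)
  have all: "ev r a * (ev r (2 * a) * (ev r (3 * a) * (ev r (4 * a) * (ev r (5 * a) * ev r (6 * a)))))
    = 1"
    if "a \<noteq> 0" for a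
  proof -
    have "ev r 1 * ev r 2 * ev r 3 * ev r 4 * ev r 5 * ev r 6 = 1"
      using cyc_norm_eq_prod[of r] assms by (simp add: prod_nonzero_Z7)
    then show ?thesis
      using that exhaust_Z7[of a] by (auto simp: numeral_Z7 ac_simps)
  qed
  have mult: "ev w a * ev r a = ev r (- a)" if "a \<noteq> 0" for a
    unfolding w using all[OF that] by (simp add: mult_ac)
  have "ev w a * cnj (ev w a) = 1" if "a \<noteq> 0" for a
  proof -
    have "ev r a \<noteq> 0"
      using all[OF that] by auto
    moreover have "cmod (ev w a) * cmod (ev r a) = cmod (cnj (ev r a))"
      unfolding norm_mult[symmetric] mult[OF that] cnj_ev ..
    ultimately have "cmod (ev w a) = 1"
      by simp
    then show ?thesis
      by (simp flip: complex_norm_square)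
  qed
  then have "(\<Sum>a\<in>UNIV. ev w a * cnj (ev w a)) = of_int ((\<Sum>x\<in>UNIV. w x)\<^sup>2) + 6"
    by (simp add: sum_Z7 ev_0 power2_eq_square)
  moreover have "(\<Sum>a\<in>UNIV. ev w a * cnj (ev w a)) = 7 * of_int (\<Sum>x\<in>UNIV. (w x)\<^sup>2)"
  proof -
    have "(\<Sum>a\<in>UNIV. ev w a * cnj (ev w a))
      = (\<Sum>a\<in>UNIV. \<Sum>x\<in>UNIV. of_int (w x) * (ev w a * chi (- (a * x))))"
      unfolding cnj_ev unfolding ev_def[of w "- _"] by (simp add: sum_distrib_left mult_ac)
    also have "\<dots> = (\<Sum>x\<in>UNIV. of_int (w x) * (\<Sum>a\<in>UNIV. ev w a * chi (- (a * x))))"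
      by (subst sum.swap) (simp add: sum_distrib_left)
    finally show ?thesis
      unfolding fourier_inversion by (simp add: sum_distrib_left power2_eq_square mult_ac)
  qed
  ultimately have "complex_of_int (7 * (\<Sum>x\<in>UNIV. (w x)\<^sup>2)) = of_int ((\<Sum>x\<in>UNIV. w x)\<^sup>2 + 6)"
    by simp
  then have sq: "7 * (\<Sum>x\<in>UNIV. (w x)\<^sup>2) = (\<Sum>x\<in>UNIV. w x)\<^sup>2 + 6"
    by (simp only: of_int_eq_iff)
  define S where "S = (\<Sum>x\<in>UNIV. w x)"
  \<comment> \<open>Modulo 7 the Parseval identity gives \<open>S = \<plusminus>1\<close>.
    Subtracting a constant \<open>t\<close> then reduces the sum to \<open>e = \<plusminus>1\<close>
    and the sum of squares to 1, so exactly one entry is nonzero.\<close>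
  have "(of_int S :: 7) ^ 2 = 1"
  proof -
    have "of_int (S\<^sup>2 + 6) = (0::7)"
      unfolding of_int_Z7_eq_0_iff S_def sq[symmetric] by simp
    then show ?thesis
      by (simp add: add_eq_0_iff2)
  qed
  then have "(of_int S :: 7) = 1 \<or> (of_int S :: 7) = - 1"
    using exhaust_Z7[of "of_int S"] by (auto simp: power2_eq_square)
  then have "of_int (S - 1) = (0::7) \<or> of_int (S + 1) = (0::7)"
    by auto
  then obtain t e where e: "S = 7 * t + e" "e = 1 \<or> e = -1"
    unfolding of_int_Z7_eq_0_iff by (metis diff_add_cancel add_diff_cancel diff_conv_add_uminus dvdE)
  define u where "u x = w x - t" for x
  have "(\<Sum>x\<in>UNIV. (u x)\<^sup>2) = (\<Sum>x\<in>UNIV. (w x)\<^sup>2) - 2 * t * S + 7 * t\<^sup>2"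
    unfolding u_def S_def sum_Z7 by (simp add: power2_eq_square algebra_simps)
  then have "7 * (\<Sum>x\<in>UNIV. (u x)\<^sup>2) = S\<^sup>2 + 6 - 14 * t * S + 49 * t\<^sup>2"
    using sq unfolding S_def[symmetric] by simp
  also have "\<dots> = e\<^sup>2 + 6"
    unfolding e(1) by (simp add: power2_eq_square algebra_simps)
  also have "\<dots> = 7"
    using e(2) by auto
  finally have usq: "(\<Sum>x\<in>UNIV. (u x)\<^sup>2) = 1"
    by simp
  have usum: "(\<Sum>x\<in>UNIV. u x) = e"
    using e(1) unfolding u_def S_def sum_Z7 by simp
  have "\<exists>j. u j \<noteq> 0"
  proof (rule ccontr)
    assume "\<not> (\<exists>j. u j \<noteq> 0)"
    then show False
      using usq by simp
  qed
  then obtain j where j: "u j \<noteq> 0" by blast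
  have rest: "(u j)\<^sup>2 + (\<Sum>x\<in>UNIV - {j}. (u x)\<^sup>2) = 1"
    using usq sum.remove[of UNIV j "\<lambda>x. (u x)\<^sup>2"] by simp
  have "(u j)\<^sup>2 > 0"
    using j by simp
  moreover have nonneg: "(\<Sum>x\<in>UNIV - {j}. (u x)\<^sup>2) \<ge> 0"
    by (rule sum_nonneg) simp
  ultimately have "(\<Sum>x\<in>UNIV - {j}. (u x)\<^sup>2) = 0"
    using rest by linarith
  then have zero: "u x = 0" if "x \<noteq> j" for x
    using that by (simp add: sum_nonneg_eq_0_iff)
  then have "(\<Sum>x\<in>UNIV - {j}. u x) = 0"
    by (intro sum.neutral) auto
  then have "u j = e"
    using usum sum.remove[of UNIV j u] by simp
  with zero have u: "u x = e * (if x = j then 1 else 0)" for x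
    by simp
  have "ev w a = of_int e * chi (a * j)" if "a \<noteq> 0" for a
  proof -
    have "ev w a = ev u a"
      using that ev_diff[of w "\<lambda>x. t" a] by (simp add: u_def[abs_def] ev_const)
    then show ?thesis
      unfolding u[abs_def] by (simp add: ev_scale ev_delta)
  qed
  then show ?thesis
    using that[of e j] e(2) by (simp flip: mult)
qed

text \<open>Squaring doubles the indices, and the cross terms come in equal pairs. On coefficients,
  doubling is expressed by \<open>4\<close>, the inverse of 2.\<close>

lemma frobenius_mod2:
  fixes q :: "7 \<Rightarrow> int"
  obtains s where "\<And>a. (ev q a)\<^sup>2 = ev q (2 * a) + 2 * ev s a"
proof -
  have "\<forall>z. even (conv q q z - q (4 * z))"
    unfolding forall_Z7 conv_def sum_Z7 by (simp add: numeral_Z7 neg_numeral_Z7)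
  then have "\<forall>z. \<exists>h. conv q q z - q (4 * z) = 2 * h"
    by blast
  then obtain h where h: "\<And>z. conv q q z - q (4 * z) = 2 * h z"
    by metis
  have "(ev q a)\<^sup>2 = ev q (2 * a) + 2 * ev h a" for a
  proof -
    have "ev (\<lambda>z. conv q q z - q (4 * z)) a = (ev q a)\<^sup>2 - ev q (2 * a)"
      by (simp only: ev_diff ev_conv power2_eq_square) (simp add: ev_mult_arg[of 2 4])
    then show ?thesis
      unfolding h ev_scale by (simp add: algebra_simps)
  qed
  then show ?thesis
    by (rule that)
qed

text \<open>Modulo 2, \<open>\<alpha>(\<omega>\<^sup>2) \<equiv> \<alpha>\<^sup>2\<close>. Hence the half norm is \<open>\<alpha>\<^sup>7\<close> and \<open>\<alpha> \<equiv> \<alpha>\<^sup>8\<close>, so \<open>\<alpha>\<close> is divisible by 2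
  if the half norm is.\<close>

lemma cyc_norm_of_even:
  assumes "even (norm_X q)" "even (norm_Y q)"
  obtains s where "cyc_norm q = 64 * cyc_norm s"
proof -
  obtain s where s: "\<And>a. (ev q a)\<^sup>2 = ev q (2 * a) + 2 * ev s a"
    using frobenius_mod2[of q] by blast
  obtain X Y where XY: "norm_X q = 2 * X" "norm_Y q = 2 * Y"
    using assms by (elim evenE)
  \<comment> \<open>\<open>g\<close> represents half of the half norm.\<close>
  define g where "g z = X * (if z = 0 then 1 else 0)
    + Y * ((if z = 1 then 1 else 0) + (if z = 2 then 1 else 0) + (if z = 4 then 1 else 0))" for z :: 7
  have g: "ev g a = of_int X + of_int Y * theta a" for a
    by (simp only: g_def[abs_def] ev_add ev_scale ev_delta theta_def) (simp add: mult.commute)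
  define q2 q4 s2 s4 where "q2 z = q (4 * z)" and "q4 z = q (2 * z)"
    and "s2 z = s (4 * z)" and "s4 z = s (2 * z)" for z :: 7
  have scaled: "ev q2 a = ev q (2 * a)" "ev q4 a = ev q (4 * a)" "ev s2 a = ev s (2 * a)"
    "ev s4 a = ev s (4 * a)" for a
    by (simp_all add: q2_def[abs_def] q4_def[abs_def] s2_def[abs_def] s4_def[abs_def] ev_mult_arg)
  \<comment> \<open>\<open>t\<close> represents \<open>q / 2\<close>. It arises from
    \<open>u4 * u2 * u^2 = 2 * u * g\<close> by applying the Frobenius relations for
    \<open>u\<close>, \<open>u2\<close>, \<open>u4\<close> in turn; the third returns to
    \<open>u\<close> since 8 is 1 modulo 7.\<close>
  define t where "t z = conv q g z - conv s (conv q2 q4) z - conv q4 s2 z - s4 z" for z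
  have "cyc_norm q = cyc_norm (\<lambda>x. 2 * (if x = 0 then 1 else 0)) * cyc_norm t"
  proof (rule cyc_norm_mult)
    fix a :: 7
    assume "a \<noteq> 0"
    define u u2 u4 where "u = ev q a" and "u2 = ev q (2 * a)" and "u4 = ev q (4 * a)"
    have eqs: "u2 = u\<^sup>2 - 2 * ev s a" "u4 = u2\<^sup>2 - 2 * ev s2 a" "u = u4\<^sup>2 - 2 * ev s4 a"
      using s[of a] s[of "2 * a"] s[of "4 * a"] by (simp_all add: u_def u2_def u4_def scaled numeral_Z7)
    have "u * u2 * u4 = 2 * ev g a"
      using ev_half_norm_theta[OF \<open>a \<noteq> 0\<close>, of q] unfolding ev_half_norm u_def u2_def u4_def g XY
      by (simp add: algebra_simps)
    then have "u4 * u2 * u\<^sup>2 = 2 * (u * ev g a)"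
      by (simp add: power2_eq_square algebra_simps)
    moreover have "u = u4 * u2 * u\<^sup>2 - 2 * (ev s a * (u2 * u4)) - 2 * (u4 * ev s2 a) - 2 * ev s4 a"
    proof -
      have "u4 * u2 * u\<^sup>2 - 2 * (ev s a * (u2 * u4)) - 2 * (u4 * ev s2 a) - 2 * ev s4 a
        = u4 * u2 * (u\<^sup>2 - 2 * ev s a) - 2 * (u4 * ev s2 a) - 2 * ev s4 a"
        by (simp add: algebra_simps)
      also have "\<dots> = u4 * (u2\<^sup>2 - 2 * ev s2 a) - 2 * ev s4 a"
        unfolding eqs(1)[symmetric] by (simp add: algebra_simps power2_eq_square)
      also have "\<dots> = u"
        unfolding eqs(2)[symmetric] using eqs(3) by (simp add: power2_eq_square)
      finally show ?thesis ..
    qed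
    ultimately have "u = 2 * (u * ev g a - ev s a * (u2 * u4) - u4 * ev s2 a - ev s4 a)"
      by (simp add: algebra_simps)
    also have "\<dots> = 2 * ev t a"
      by (simp add: t_def[abs_def] ev_diff ev_conv u_def u2_def u4_def scaled)
    finally show "ev q a = ev (\<lambda>x. 2 * (if x = 0 then 1 else 0)) a * ev t a"
      unfolding ev_scale ev_delta u_def by simp
  qed
  moreover have "cyc_norm (\<lambda>x. 2 * (if x = 0 then 1 else 0)) = 64"
    by (simp add: cyc_norm_eq_explicit) (simp add: cyc_norm_explicit_def)
  ultimately show ?thesis
    using that by simp
qed

subsection \<open>Constraints on the norms along the lines of characters\<close>

lemma sum_poly_Z7:
  fixes e0 :: 7
  shows "(\<Sum>b\<in>UNIV. e0 + e1 * b + e2 * b ^ 2 + e3 * b ^ 3 + e4 * b ^ 4 + e5 * b ^ 5 + e6 * b ^ 6)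
    = 6 * e6"
proof -
  have "(\<Sum>b\<in>(UNIV::7 set). b ^ 6) = 6"
    by (simp add: sum_Z7 power_6_Z7)
  then show ?thesis
    using power_sum_Z7[of 0] power_sum_Z7[of 1]
    by (simp add: sum.distrib power_sum_Z7 numeral_Z7 flip: sum_distrib_left)
qed

text \<open>The summand is the cumulant of \<open>norm_Y_mod7\<close> with moments 0 to 3 replaced
  by polynomials in \<open>b\<close> of degrees 0, 2, 3, 4. Only its coefficient
  \<open>2 * p2 ^ 3\<close> of \<open>b ^ 6\<close> survives, multiplied by 6.\<close>

lemma sum_cumulant_Z7:
  fixes a :: 7
  shows "(\<Sum>b\<in>UNIV. a ^ 2 * (t0 + t1 * b + t2 * b ^ 2 + t3 * b ^ 3 + t4 * b ^ 4)
      + 4 * a * (p0 + p1 * b + p2 * b ^ 2) * (c0 + c1 * b + c2 * b ^ 2 + c3 * b ^ 3)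
      + 2 * (p0 + p1 * b + p2 * b ^ 2) ^ 3) = 5 * p2 ^ 3"
    (is "(\<Sum>b\<in>UNIV. ?f b) = _")
proof -
  have "?f b = (a ^ 2 * t0 + 4 * a * (p0 * c0) + 2 * p0 ^ 3)
    + (a ^ 2 * t1 + 4 * a * (p0 * c1 + p1 * c0) + 6 * p0 ^ 2 * p1) * b
    + (a ^ 2 * t2 + 4 * a * (p0 * c2 + p1 * c1 + p2 * c0) + 6 * p0 ^ 2 * p2 + 6 * p0 * p1 ^ 2) * b ^ 2
    + (a ^ 2 * t3 + 4 * a * (p0 * c3 + p1 * c2 + p2 * c1) + 2 * p1 ^ 3 + 12 * p0 * p1 * p2) * b ^ 3
    + (a ^ 2 * t4 + 4 * a * (p1 * c3 + p2 * c2) + 6 * p0 * p2 ^ 2 + 6 * p1 ^ 2 * p2) * b ^ 4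
    + (4 * a * (p2 * c3) + 6 * p1 * p2 ^ 2) * b ^ 5
    + (2 * p2 ^ 3) * b ^ 6" for b
    by (simp add: algebra_simps power_numeral_reduce)
  then show ?thesis
    by (simp only: sum_poly_Z7) (simp add: numeral_Z7)
qed

lemma sum_norm_Y:
  assumes "moment2 v 0 1 = 0"
    and r: "\<And>b. pi_quotient (push_line v b) (r b)"
  shows "(\<Sum>b\<in>UNIV. of_int (norm_Y (r b))) = 5 * moment2 v 0 2 ^ 3"
proof -
  have q: "moment 1 (push_line v b) = moment 0 (r b)"
    "moment 2 (push_line v b) = 2 * moment 1 (r b) + moment 0 (r b)"
    "moment 3 (push_line v b) = 3 * moment 2 (r b) + 3 * moment 1 (r b) + moment 0 (r b)"
    "moment 4 (push_line v b) = 4 * moment 3 (r b) + 6 * moment 2 (r b) + 4 * moment 1 (r b)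
      + moment 0 (r b)" for b
    using r[of b] unfolding pi_quotient_def by blast+
  define a where "a = moment2 v 1 0"
  have 0: "moment 0 (r b) = a" for b
    using assms(1) q(1)[of b] by (simp add: moment_push_line_expand a_def del: One_nat_def)
  \<comment> \<open>The relations of \<open>pi_quotient\<close> are solved upwards for the moments
    of \<open>r b\<close>; the factors 4, 5, 2 are the inverses of 2, 3, 4 modulo 7.\<close>
  define p0 p1 p2 where "p0 = 4 * (moment2 v 2 0 - a)" and "p1 = moment2 v 1 1" and "p2
    = 4 * moment2 v 0 2"
  have 1: "moment 1 (r b) = p0 + p1 * b + p2 * b ^ 2" for b
  proof -
    have "4 * (moment 2 (push_line v b) - a) = moment 1 (r b)"
      unfolding q(2) 0 by (simp add: numeral_Z7 mult.assoc[symmetric])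
    then show ?thesis
      by (simp add: moment_push_line_expand p0_def p1_def p2_def algebra_simps numeral_Z7)
  qed
  define c0 c1 c2 c3 where "c0 = 5 * moment2 v 3 0 - p0 - 5 * a" and "c1 = moment2 v 2 1 - p1"
    and "c2 = moment2 v 1 2 - p2" and "c3 = 5 * moment2 v 0 3"
  have 2: "moment 2 (r b) = c0 + c1 * b + c2 * b ^ 2 + c3 * b ^ 3" for b
  proof -
    have "5 * (moment 3 (push_line v b) - 3 * moment 1 (r b) - a) = moment 2 (r b)"
      unfolding q(3) 0 by (simp add: numeral_Z7 mult.assoc[symmetric])
    then show ?thesis
      unfolding 1 by (simp add: moment_push_line_expand c0_def c1_def c2_def c3_def algebra_simps
        numeral_Z7)
  qed
  define t0 t1 t2 t3 t4 where "t0 = 2 * moment2 v 4 0 - 5 * c0 - p0 - 2 * a" and "t1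
    = moment2 v 3 1 - 5 * c1 - p1"
    and "t2 = 5 * moment2 v 2 2 - 5 * c2 - p2" and "t3 = moment2 v 1 3 - 5 * c3" and "t4
      = 2 * moment2 v 0 4"
  have 3: "moment 3 (r b) = t0 + t1 * b + t2 * b ^ 2 + t3 * b ^ 3 + t4 * b ^ 4" for b
  proof -
    have "2 * (moment 4 (push_line v b) - 6 * moment 2 (r b) - 4 * moment 1 (r b) - a) = moment 3 (r b)"
      unfolding q(4) 0 by (simp add: numeral_Z7 mult.assoc[symmetric])
    then show ?thesis
      unfolding 1 2 by (simp add: moment_push_line_expand t0_def t1_def t2_def t3_def t4_def
        algebra_simps numeral_Z7)
  qed
  have "(\<Sum>b\<in>UNIV. of_int (norm_Y (r b))) = 5 * p2 ^ 3"
    unfolding norm_Y_mod7 0 1 2 3 by (rule sum_cumulant_Z7)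
  also have "p2 ^ 3 = moment2 v 0 2 ^ 3"
    by (simp add: p2_def power_mult_distrib numeral_Z7)
  finally show ?thesis .
qed

lemma cyc_norm_ge_8:
  assumes "moment 0 q \<noteq> 0" "cyc_norm q \<noteq> 1"
  shows "cyc_norm q \<ge> 8"
proof -
  have "of_int (cyc_norm q - 1) = (0::7)"
    using fermat_Z7[OF assms(1)] by (simp add: cyc_norm_mod7)
  then have "7 dvd cyc_norm q - 1"
    unfolding of_int_Z7_eq_0_iff .
  then show ?thesis
    using assms(2) cyc_norm_nonneg[of q] by presburger
qed

text \<open>The bound forces \<open>\<bar>Y\<bar> < 5\<close>, so \<open>Y = \<plusminus>2\<close>
  and the norm is 7 plus a square that is 1 modulo 7. The square 1 gives norm 8, excluded by
  divisibility by 64; the next such square is 36, and \<open>36 + 7\<close> is the origin of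
  43.\<close>

lemma exceptional_norm:
  assumes "cyc_norm q < 43" "moment 0 q \<noteq> 0" "(of_int (norm_Y q) :: 7) ^ 2 = 4"
  shows False
proof -
  define X Y where "X = norm_X q" and "Y = norm_Y q"
  have four: "4 * cyc_norm q = (2 * X - Y)\<^sup>2 + 7 * Y\<^sup>2"
    unfolding X_def Y_def by (rule four_cyc_norm)
  have "of_int (Y\<^sup>2 - 4) = (0::7)"
    using assms(3) by (simp add: Y_def)
  then have dvd: "7 dvd Y\<^sup>2 - 4"
    unfolding of_int_Z7_eq_0_iff .
  have "Y\<^sup>2 < 25"
    using four assms(1) zero_le_power2[of "2 * X - Y"] by linarith
  then have "\<bar>Y\<bar> < 5"
    using power2_less_imp_less[of "\<bar>Y\<bar>" 5] by simp
  then have "Y \<in> {-4, -3, -2, -1, 0, 1, 2, 3, 4}"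
    by auto
  then have "Y = 2 \<or> Y = - 2"
    using dvd by auto
  then obtain y where y: "Y = 2 * y" "y = 1 \<or> y = - 1"
    by force
  have sq: "cyc_norm q = (X - y)\<^sup>2 + 7"
    using four y by (auto simp: power2_eq_square algebra_simps)
  have "of_int ((X - y)\<^sup>2 - 1) = (0::7)"
    using cyc_norm_mod7[of q] fermat_Z7[OF assms(2)] unfolding sq by (simp add: numeral_Z7)
  then have dvd: "7 dvd (X - y)\<^sup>2 - 1"
    unfolding of_int_Z7_eq_0_iff .
  have "(X - y)\<^sup>2 < 6\<^sup>2"
    using sq assms(1) by simp
  then have "\<bar>X - y\<bar> < 6"
    using power2_less_imp_less[of "\<bar>X - y\<bar>" 6] by simp
  moreover have "d \<in> {-5, -4, -3, -2, -1, 0, 1, 2, 3, 4, 5}" if "\<bar>d\<bar> < 6" for d :: int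
    using that by (simp only: insert_iff empty_iff) presburger
  ultimately have "X - y \<in> {-5, -4, -3, -2, -1, 0, 1, 2, 3, 4, 5}"
    by blast
  then have x: "X - y = 1 \<or> X - y = - 1"
    using dvd by auto
  then have "cyc_norm q = 8"
    using sq by auto
  moreover have "X = 2 \<or> X = 0 \<or> X = - 2"
    using x y(2) by linarith
  then have "even (norm_X q)" "even (norm_Y q)"
    using y(1) unfolding X_def Y_def by auto
  then obtain s where "cyc_norm q = 64 * cyc_norm s"
    by (rule cyc_norm_of_even)
  ultimately show False
    by presburger
qed

lemma prod_cyc_norm_ge_43:
  fixes r :: "7 \<Rightarrow> 7 \<Rightarrow> int"
  assumes "\<And>b. moment 0 (r b) \<noteq> 0" "\<And>b. cyc_norm (r b) \<noteq> 0"
    and sum: "(\<Sum>b\<in>UNIV. of_int (norm_Y (r b))) = 5 * c ^ 3" and "c \<noteq> (0::7)"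
  shows "(\<Prod>b\<in>UNIV. cyc_norm (r b)) \<ge> 43"
proof (rule ccontr)
  assume "\<not> ?thesis"
  then have less: "(\<Prod>b\<in>UNIV. cyc_norm (r b)) < 43"
    by simp
  have ge1: "cyc_norm (r b) \<ge> 1" for b
    using cyc_norm_nonneg[of "r b"] assms(2)[of b] by linarith
  have ge8: "cyc_norm (r b) \<ge> 8" if "cyc_norm (r b) \<noteq> 1" for b
    using cyc_norm_ge_8[OF assms(1) that] .
  have prod_ge1: "(\<Prod>b\<in>B. cyc_norm (r b)) \<ge> 1" for B
    by (rule prod_ge_1) (rule ge1)
  \<comment> \<open>Two norms different from 1 would give a product of at least 64. If all norms are
    1, any index serves as \<open>b0\<close>.\<close>
  obtain b0 where b0: "\<And>b. b \<noteq> b0 \<Longrightarrow> cyc_norm (r b) = 1"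
  proof (cases "\<exists>b. cyc_norm (r b) \<noteq> 1")
    case True
    then obtain b0 where b0: "cyc_norm (r b0) \<noteq> 1" by blast
    have "cyc_norm (r b) = 1" if "b \<noteq> b0" for b
    proof (rule ccontr)
      assume "cyc_norm (r b) \<noteq> 1"
      have "(\<Prod>b\<in>UNIV. cyc_norm (r b))
        = cyc_norm (r b0) * (cyc_norm (r b) * (\<Prod>b\<in>UNIV - {b0} - {b}. cyc_norm (r b)))"
        using that by (subst prod.remove[of _ b0], simp, simp, subst prod.remove[of _ b]) auto
      moreover have "cyc_norm (r b0) * (cyc_norm (r b) * (\<Prod>b\<in>UNIV - {b0} - {b}. cyc_norm (r b))) \<ge> 8 * (8
        * 1)"
        by (intro mult_mono ge8 b0 \<open>cyc_norm (r b) \<noteq> 1\<close> prod_ge1 mult_nonneg_nonneg cyc_norm_nonneg) auto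
      ultimately show False
        using less by simp
    qed
    then show ?thesis by (rule that)
  next
    case False
    then show ?thesis using that[of 0] by blast
  qed
  have "cyc_norm (r b0) < 43"
    using less b0 by (subst (asm) prod.remove[of _ b0]) auto
  moreover have "norm_Y (r b) = 0" if "b \<noteq> b0" for b
  proof (rule ccontr)
    assume "norm_Y (r b) \<noteq> 0"
    then have "(norm_Y (r b))\<^sup>2 > 0"
      by simp
    moreover have "4 = (2 * norm_X (r b) - norm_Y (r b))\<^sup>2 + 7 * (norm_Y (r b))\<^sup>2"
      using four_cyc_norm[of "r b"] b0[OF that] by simp
    moreover have "(2 * norm_X (r b) - norm_Y (r b))\<^sup>2 \<ge> 0"
      by simp
    ultimately show False
      by linarith
  qed
  then have "(\<Sum>b\<in>UNIV - {b0}. of_int (norm_Y (r b))) = (0::7)"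
    by (intro sum.neutral) auto
  then have "of_int (norm_Y (r b0)) = 5 * c ^ 3"
    using sum sum.remove[of UNIV b0 "\<lambda>b. of_int (norm_Y (r b)) :: 7"] by simp
  \<comment> \<open>Squaring removes the dependence on \<open>c\<close>:
    \<open>25 * c ^ 6 = 4\<close> modulo 7.\<close>
  then have "(of_int (norm_Y (r b0)) :: 7) ^ 2 = 4"
    using fermat_Z7[OF \<open>c \<noteq> 0\<close>] by (simp add: power_mult_distrib numeral_Z7 flip: power_mult)
  ultimately show False
    using exceptional_norm assms(1) by blast
qed

text \<open>Conjugation multiplies \<open>\<omega> - 1\<close> by \<open>- 1 / \<omega>\<close>, so
  \<open>n\<close> such factors change the sign by \<open>(- 1) ^ n\<close> and the shift by
  \<open>- n\<close>. The moment form lets \<open>e\<close> and \<open>j\<close> be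
  computed.\<close>

lemma conj_relation:
  assumes ev: "\<And>a. a \<noteq> 0 \<Longrightarrow> ev q a = (chi a - 1) ^ n * ev r a" and "cyc_norm r = 1"
  obtains e j where "e = 1 \<or> e = (- 1 :: int)"
    "\<And>a. a \<noteq> 0 \<Longrightarrow> ev q (- a) = of_int e * chi (a * j) * ev q a"
    "\<And>k. k < 6 \<Longrightarrow> (- 1) ^ k * moment k q = of_int e * moment k (\<lambda>x. q (x - j))"
proof -
  obtain e j where e: "e = 1 \<or> e = (- 1 :: int)"
    and r: "\<And>a. a \<noteq> 0 \<Longrightarrow> ev r (- a) = of_int e * chi (a * j) * ev r a"
    using unit_conj[OF \<open>cyc_norm r = 1\<close>] by blast
  define e' j' where "e' = (- 1) ^ n * e" and "j' = j - of_nat n"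
  have rel: "ev q (- a) = of_int e' * chi (a * j') * ev q a" if "a \<noteq> 0" for a
  proof -
    have "chi (- a) - 1 = (- 1) * chi (- a) * (chi a - 1)"
      by (simp add: algebra_simps flip: chi_add)
    then have "(chi (- a) - 1) ^ n = (- 1) ^ n * chi (- a) ^ n * (chi a - 1) ^ n"
      by (simp only: power_mult_distrib)
    moreover have "chi (- a) ^ n = chi (- (a * of_nat n))"
      by (induction n) (simp_all add: algebra_simps flip: chi_add)
    moreover have "chi (a * j') = chi (a * j) * chi (- (a * of_nat n))"
      by (simp add: j'_def algebra_simps flip: chi_add)
    ultimately show ?thesis
      using that by (simp add: ev r e'_def algebra_simps)
  qed
  have "moment k (\<lambda>x. q (- x)) = moment k (\<lambda>x. e' * q (x - j'))" if "k < 6" for k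
    by (rule moment_cong[OF _ that]) (simp add: ev_uminus ev_scale ev_shift rel)
  then have "(- 1) ^ k * moment k q = of_int e' * moment k (\<lambda>x. q (x - j'))" if "k < 6" for k
    using that by (simp add: moment_uminus moment_scale)
  moreover have "e' = 1 \<or> e' = - 1"
    using e by (cases "even n") (auto simp: e'_def)
  ultimately show ?thesis
    using that rel by blast
qed

lemma det_unit_case:
  assumes M: "moment2 v 0 0 = 0" "moment2 v 0 1 = 0" "moment2 v 0 2 = 0" "moment2 v 1 0 \<noteq> 0"
    "moment2 v 0 3 \<noteq> 0"
    and r: "\<And>a b. a \<noteq> 0 \<Longrightarrow> ev (push_line v b) a = (chi a - 1) * ev (r b) a" "\<And>b. cyc_norm (r b) = 1"
    and s: "\<And>a. a \<noteq> 0 \<Longrightarrow> ev (push_snd v) a = (chi a - 1) ^ 3 * ev s a" "cyc_norm s = 1"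
  shows "49 dvd (\<Sum>g\<in>UNIV. v $ g)"
proof -
  \<comment> \<open>\<open>P + b * Q\<close> is the shift forced by second moments on the line of
    slope \<open>b\<close>. It is affine in \<open>b\<close> because
    \<open>moment2 v 0 2 = 0\<close>; the fifth power of \<open>moment2 v 1 0\<close> is its
    inverse.\<close>
  define P Q where "P = - (moment2 v 2 0 * moment2 v 1 0 ^ 5)" and "Q
    = - (2 * moment2 v 1 1 * moment2 v 1 0 ^ 5)"
  have self_eq: "x = 0" if "x = - x" for x :: 7
  proof -
    have "2 * x = 0"
      using that by (metis add.right_inverse mult_2)
    then show ?thesis
      by (simp add: mult_eq_0_Z7)
  qed
  have rel: "fourier v (- a) (- (a * b)) = - chi (a * P + a * b * Q) * fourier v a (a * b)" if "a \<noteq> 0"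
    for a b
  proof -
    obtain e j where e: "e = 1 \<or> e = (- 1 :: int)"
      and ev: "\<And>a. a \<noteq> 0 \<Longrightarrow> ev (push_line v b) (- a) = of_int e * chi (a * j) * ev (push_line v b) a"
      and moment: "\<And>k. k < 6 \<Longrightarrow> (- 1) ^ k * moment k (push_line v b)
        = of_int e * moment k (\<lambda>x. push_line v b (x - j))"
      using conj_relation[of "push_line v b" 1 "r b"] r by auto
    \<comment> \<open>First moments give \<open>- A = e * A\<close> with
      \<open>A = moment2 v 1 0\<close> nonzero.\<close>
    have "e = - 1"
      using moment[of 1] e M self_eq[of "moment2 v 1 0"]
      by (auto simp: moment_shift_expand moment_push_line_expand simp del: One_nat_def)
    then have "2 * moment 2 (push_line v b) + 2 * (j * moment2 v 1 0) = 0"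
      using moment[of 2] M by (simp add: moment_shift_expand moment_push_line_expand algebra_simps del:
        One_nat_def)
    then have "2 * (moment 2 (push_line v b) + j * moment2 v 1 0) = 0"
      by (simp only: distrib_left)
    then have "moment 2 (push_line v b) + j * moment2 v 1 0 = 0"
      unfolding mult_eq_0_Z7 by simp
    then have "j * moment2 v 1 0 = - moment 2 (push_line v b)"
      by (metis add.commute eq_neg_iff_add_eq_0)
    then have "j * moment2 v 1 0 * moment2 v 1 0 ^ 5 = - moment 2 (push_line v b) * moment2 v 1 0 ^ 5"
      by (simp only:)
    moreover have "moment2 v 1 0 * moment2 v 1 0 ^ 5 = 1"
      using fermat_Z7[OF M(4)] by (simp add: power_numeral_reduce)
    ultimately have "j = - moment 2 (push_line v b) * moment2 v 1 0 ^ 5"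
      by (simp add: mult.assoc)
    also have "\<dots> = P + b * Q"
      using M by (simp add: moment_push_line_expand P_def Q_def algebra_simps)
    finally have "j = P + b * Q" .
    with ev[OF that] \<open>e = - 1\<close> show ?thesis
      by (simp add: ev_push_line algebra_simps)
  qed
  obtain e j where e: "e = 1 \<or> e = (- 1 :: int)"
    and ev_s: "\<And>a. a \<noteq> 0 \<Longrightarrow> ev (push_snd v) (- a) = of_int e * chi (a * j) * ev (push_snd v) a"
    and moment: "\<And>k. k < 6 \<Longrightarrow> (- 1) ^ k * moment k (push_snd v)
      = of_int e * moment k (\<lambda>x. push_snd v (x - j))"
    using conj_relation[OF s] by blast
  have moment_s: "moment 0 (push_snd v) = 0" "moment 1 (push_snd v) = 0" "moment 2 (push_snd v) = 0"
    "moment 3 (push_snd v) \<noteq> 0"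
    unfolding moment_push_snd using M by auto
  have "e = - 1"
    using moment[of 3] e moment_s self_eq[of "moment 3 (push_snd v)"]
    by (auto simp: moment_shift_expand simp del: One_nat_def)
  \<comment> \<open>The coefficients of \<open>F(1/x, 1/y) + x^P y^Q F(x, y)\<close>. By
    \<open>rel\<close> its transform vanishes wherever the first argument is nonzero.\<close>
  define G :: "(int, C7xC7) vec" where "G = (\<chi> g. v $ (- g) + v $ (g - (P, Q)))"
  have G: "G $ (i, k) = v $ (- i, - k) + v $ (i - P, k - Q)" for i k
    by (simp add: G_def)
  have fourier_G: "fourier G c d = fourier v (- c) (- d) + chi (c * P + d * Q) * fourier v c d" for c d
  proof -
    have "fourier G c d = (\<Sum>g\<in>UNIV. of_int (v $ (- g)) * pair_chi g (c, d))
        + (\<Sum>g\<in>UNIV. of_int (v $ (g - (P, Q))) * pair_chi g (c, d))"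
      by (simp add: fourier_alt G_def distrib_right sum.distrib)
    moreover have "(\<Sum>g\<in>UNIV. of_int (v $ (- g)) * pair_chi g (c, d))
      = (\<Sum>g\<in>UNIV. of_int (v $ g) * pair_chi g (- c, - d))"
      by (rule sum.reindex_bij_witness[of _ uminus uminus]) (auto simp: pair_chi_minus)
    moreover have "(\<Sum>g\<in>UNIV. of_int (v $ (g - (P, Q))) * pair_chi g (c, d))
        = (\<Sum>g\<in>UNIV. of_int (v $ g) * pair_chi (g + (P, Q)) (c, d))"
      by (rule sum.reindex_bij_witness[of _ "\<lambda>g. g + (P, Q)" "\<lambda>g. g - (P, Q)"]) auto
    moreover have "pair_chi (P, Q) (c, d) = chi (c * P + d * Q)"
      by (simp add: pair_chi_def)
    ultimately show ?thesis
      by (simp add: fourier_alt pair_chi_add sum_distrib_left ac_simps)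
  qed
  have fourier_G_0: "fourier G c d = 0" if "c \<noteq> 0" for c d
  proof -
    have "c * (c ^ 5 * d) = d"
      using fermat_Z7[OF that] by (simp add: power_numeral_reduce flip: mult.assoc)
    then show ?thesis
      using rel[OF that, of "c ^ 5 * d"] by (simp add: fourier_G)
  qed
  define h where "h k = G $ (0, k)" for k
  have Gh: "G $ (i, k) = h k" for i k
    unfolding h_def
  proof (rule ev_eq_0_imp_const[of "\<lambda>i. G $ (i, k)"])
    fix c :: 7
    assume "c \<noteq> 0"
    have "(\<Sum>k\<in>UNIV. ev (\<lambda>i. G $ (i, k)) c * chi (d * k)) = fourier G c d" for d
    proof -
      have "(\<Sum>k\<in>UNIV. ev (\<lambda>i. G $ (i, k)) c * chi (d * k))
        = (\<Sum>k\<in>UNIV. \<Sum>i\<in>UNIV. of_int (G $ (i, k)) * chi (c * i + d * k))"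
        by (simp add: ev_def sum_distrib_right chi_add mult.assoc)
      also have "\<dots> = (\<Sum>(i, k)\<in>UNIV \<times> UNIV. of_int (G $ (i, k)) * chi (c * i + d * k))"
        by (subst sum.swap) (rule sum.cartesian_product)
      finally show ?thesis
        by (simp add: fourier_def)
    qed
    then show "ev (\<lambda>i. G $ (i, k)) c = 0"
      using fourier_inversion_complex[of "\<lambda>k. ev (\<lambda>i. G $ (i, k)) c" k] fourier_G_0[OF \<open>c \<noteq> 0\<close>] by simp
  qed
  have push_line_G: "push_snd G n = 7 * h n" for n
    by (simp add: push_snd_def Gh)
  have "push_snd G n = push_snd v (- n) + push_snd v (n - Q)" for n
  proof -
    have "(\<Sum>i\<in>UNIV. v $ (- i, - n)) = push_snd v (- n)"
      unfolding push_snd_def by (rule sum.reindex_bij_witness[of _ uminus uminus]) auto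
    moreover have "(\<Sum>i\<in>UNIV. v $ (i - P, n - Q)) = push_snd v (n - Q)"
      unfolding push_snd_def by (rule sum.reindex_bij_witness[of _ "\<lambda>i. i + P" "\<lambda>i. i - P"]) auto
    ultimately show ?thesis
      by (simp add: push_snd_def G sum.distrib)
  qed
  then have h: "7 * h n = push_snd v (- n) + push_snd v (n - Q)" for n
    by (simp add: push_line_G)
  \<comment> \<open>Since moments 0 to 2 of \<open>push_snd v\<close> vanish and moment 3 does not,
    order 4 is the lowest at which the shift enters. \<open>Q\<close> and \<open>j\<close> satisfy
    the same linear equation there.\<close>
  have "0 = moment 4 (\<lambda>n. 7 * h n)"
    by (simp add: moment_scale numeral_Z7)
  also have "\<dots> = 2 * moment 4 (push_snd v) + 4 * Q * moment 3 (push_snd v)"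
    unfolding h moment_add moment_uminus moment_shift_expand moment_s by simp
  finally have "4 * Q * moment 3 (push_snd v) = - 2 * moment 4 (push_snd v)"
    by (simp add: eq_neg_iff_add_eq_0 add.commute)
  moreover have "4 * j * moment 3 (push_snd v) = - 2 * moment 4 (push_snd v)"
    using moment[of 4] \<open>e = - 1\<close> unfolding moment_shift_expand moment_s
    by (simp add: eq_neg_iff_add_eq_0 algebra_simps)
  ultimately have "4 * (Q - j) * moment 3 (push_snd v) = 0"
    by (simp add: algebra_simps)
  then have "Q - j = 0"
    using moment_s(4) unfolding mult_eq_0_Z7 by simp
  then have "Q = j"
    by simp
  have h_const: "h n = h 0" for n
  proof (rule ev_eq_0_imp_const)
    fix a :: 7
    assume "a \<noteq> 0"
    have "7 * ev h a = ev (\<lambda>n. 7 * h n) a"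
      by (simp only: ev_scale) simp
    also have "\<dots> = 0"
      unfolding h ev_add ev_uminus ev_shift ev_s[OF \<open>a \<noteq> 0\<close>] \<open>Q = j\<close> \<open>e = - 1\<close> by simp
    finally show "ev h a = 0"
      by simp
  qed
  have "G $ g = h 0" for g
    using Gh[of "fst g" "snd g"] h_const[of "snd g"] by simp
  then have "(\<Sum>g\<in>UNIV. G $ g) = 49 * h 0"
    by simp
  moreover have "(\<Sum>g\<in>UNIV. G $ g) = 2 * (\<Sum>g\<in>UNIV. v $ g)"
  proof -
    have "(\<Sum>g\<in>UNIV. v $ (- g)) = (\<Sum>g\<in>UNIV. v $ g)"
      by (rule sum.reindex_bij_witness[of _ uminus uminus]) auto
    moreover have "(\<Sum>g\<in>UNIV. v $ (g - (P, Q))) = (\<Sum>g\<in>UNIV. v $ g)"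
      by (rule sum.reindex_bij_witness[of _ "\<lambda>g. g + (P, Q)" "\<lambda>g. g - (P, Q)"]) auto
    ultimately show ?thesis
      by (simp add: G_def sum.distrib)
  qed
  ultimately show ?thesis
    by presburger
qed

subsection \<open>Witnesses\<close>

definition sparse :: "(int \<times> C7xC7) list \<Rightarrow> (int, C7xC7) vec"
  where "sparse xs = (\<chi> g. \<Sum>(c, h)\<leftarrow>xs. if g = h then c else 0)"

lemma sparse_Nil: "sparse [] = 0"
  by (simp add: sparse_def zero_vec_def)

lemma sparse_Cons: "sparse ((c, h) # xs) $ g = (if g = h then c else 0) + sparse xs $ g"
  by (simp add: sparse_def)

lemma sum_sparse: "(\<Sum>g\<in>UNIV. sparse xs $ g) = (\<Sum>(c, h)\<leftarrow>xs. c)"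
  by (induction xs) (auto simp: sparse_Nil sparse_Cons sum.distrib)

lemma push_line_sparse: "push_line (sparse xs) b n = (\<Sum>(c, (i, j))\<leftarrow>xs. if n = i + b * j then c else 0)"
proof (induction xs)
  case (Cons x xs)
  obtain c i j where x: "x = (c, (i, j))"
    by (metis surj_pair)
  have "(\<Sum>k\<in>UNIV. if n - b * k = i \<and> k = j then c else 0) = (\<Sum>k\<in>UNIV. if k = j then if n
    = i + b * j then c else 0 else 0)"
    by (intro sum.cong) (auto simp: algebra_simps)
  then show ?case
    using Cons by (simp add: x push_line_def sparse_Cons sum.distrib)
qed (simp add: push_line_def sparse_Nil)

lemma push_snd_sparse: "push_snd (sparse xs) n = (\<Sum>(c, (i, j))\<leftarrow>xs. if n = j then c else 0)"
proof (induction xs)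
  case (Cons x xs)
  obtain c i j where x: "x = (c, (i, j))"
    by (metis surj_pair)
  have "(\<Sum>k\<in>UNIV. if k = i \<and> n = j then c else 0) = (\<Sum>k\<in>UNIV. if k = i then if n
    = j then c else 0 else 0)"
    by (intro sum.cong) auto
  then show ?case
    using Cons by (simp add: x push_snd_def sparse_Cons sum.distrib)
qed (simp add: push_snd_def sparse_Nil)

lemma cyc_norm_add_const: "cyc_norm (\<lambda>x. q x + c) = cyc_norm q"
  by (rule cyc_norm_cong) (simp add: ev_add ev_const)

text \<open>A constant is seen only by the trivial character. Applied to a vector of sum 0 whose
  norms multiply to \<open>7 ^ 10\<close>, this yields every multiple of
  \<open>7 ^ 12\<close>.\<close>

lemma group_det_add_const:
  "group_det (v + (\<chi> g. n))
    = ((\<Sum>g\<in>UNIV. v $ g) + 49 * n) * (\<Prod>b\<in>UNIV. cyc_norm (push_line v b)) * cyc_norm (push_snd v)"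
proof -
  have "push_line (v + (\<chi> g. n)) b = (\<lambda>x. push_line v b x + 7 * n)"
    "push_snd (v + (\<chi> g. n)) = (\<lambda>x. push_snd v x + 7 * n)" for b
    by (auto simp: push_line_def push_snd_def sum.distrib)
  then show ?thesis
    by (simp add: group_det_eq cyc_norm_add_const sum.distrib)
qed

text \<open>The following coefficients were found by a computer search.\<close>

lemma det_43: "group_det (sparse [(1, (0, 0)), (1, (3, 6)), (1, (4, 4)), (1, (5, 3)), (1, (1, 1)),
    (1, (4, 0)), (1, (6, 4))]) = 43 * 7 ^ 10"
  unfolding group_det_eq sum_sparse prod_Z7 cyc_norm_eq_explicit push_line_sparse push_snd_sparse
  by (simp add: numeral_Z7) (simp add: cyc_norm_explicit_def)

lemma det_8: "group_det (sparse [(1, (0, 0)), (1, (3, 0)), (1, (3, 6)), (1, (2, 6)), (1, (6, 6)), (1, (6,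
    5)), (1, (4, 0)), (1, (0, 6)), (-1, (2, 1))]) = 8 * 7 ^ 11"
  unfolding group_det_eq sum_sparse prod_Z7 cyc_norm_eq_explicit push_line_sparse push_snd_sparse
  by (simp add: numeral_Z7) (simp add: cyc_norm_explicit_def)

lemma det_7_12: "group_det (sparse [(1, (0, 3)), (1, (5, 5)), (1, (3, 4)), (-1, (3, 2)), (-1, (6, 3)),
    (-1, (1, 1))] + (\<chi> g. n)) = 7 ^ 12 * n"
  unfolding group_det_add_const sum_sparse prod_Z7 cyc_norm_eq_explicit push_line_sparse push_snd_sparse
  by (simp add: numeral_Z7) (simp add: cyc_norm_explicit_def)

subsection \<open>Lower bounds\<close>

lemma abs_ge_of_dvd: "m \<le> \<bar>n\<bar>" if "m dvd n" "n \<noteq> 0" for m n :: int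
  using dvd_imp_le_int[OF that(2,1)] by simp

lemma moment2_0_0_eq_0_iff: "moment2 v 0 0 = 0 \<longleftrightarrow> 7 dvd (\<Sum>g\<in>UNIV. v $ g)"
  unfolding moment2_0_0 of_int_Z7_eq_0_iff ..

lemma prod_cyc_norm_mod7:
  assumes "\<And>b. moment 0 (r b) \<noteq> 0"
  shows "of_int (\<Prod>b\<in>(UNIV::7 set). cyc_norm (r b)) = (1::7)"
  using fermat_Z7[OF assms] by (simp add: cyc_norm_mod7)

text \<open>Absolute values let the same bounds exclude the negatives of \<open>7 ^ 10\<close> and
  \<open>7 ^ 11\<close>.\<close>

definition det_bounds :: "int \<Rightarrow> bool"
  where "det_bounds D \<longleftrightarrow> 43 * 7 ^ 10 \<le> \<bar>D\<bar> \<and> (7 ^ 11 dvd D \<and> \<not> 7 ^ 12 dvd D \<longrightarrow> 8 * 7 ^ 11 \<le> \<bar>D\<bar>)"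

text \<open>\<open>7 ^ 12 = 49 * 7 ^ 10\<close> exceeds \<open>43 * 7 ^ 10\<close>, and the second
  bound is vacuous.\<close>

lemma det_bounds_of_dvd: "det_bounds D" if "7 ^ 12 dvd D" "D \<noteq> 0"
  using that abs_ge_of_dvd[OF that] by (auto simp: det_bounds_def)

lemma det_bounds_normalized:
  assumes M: "moment2 v 0 0 = 0" "moment2 v 0 1 = 0" "moment2 v 1 0 \<noteq> 0" and D: "group_det v \<noteq> 0"
  shows "det_bounds (group_det v)"
proof -
  have "\<exists>r. pi_quotient (push_line v b) r" for b
    by (rule ex_pi_quotient) (simp add: moment_push_line_expand M)
  then obtain r where r: "\<And>b. pi_quotient (push_line v b) (r b)"
    by metis
  obtain s1 where s1: "pi_quotient (push_snd v) s1"
    using ex_pi_quotient[of "push_snd v"] M by (auto simp: moment_push_snd)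
  then have "moment 0 s1 = 0"
    using M(2) by (simp add: pi_quotient_def moment_push_snd)
  then obtain s2 where s2: "pi_quotient s1 s2"
    using ex_pi_quotient by blast
  obtain m where m: "(\<Sum>g\<in>UNIV. v $ g) = 7 * m"
    using M(1) unfolding moment2_0_0_eq_0_iff by blast
  have r0: "moment 0 (r b) \<noteq> 0" for b
    using r[of b] M(2,3) by (auto simp: pi_quotient_def moment_push_line_expand simp del: One_nat_def)
  define R where "R = (\<Prod>b\<in>UNIV. cyc_norm (r b))"
  have prod_push_line: "(\<Prod>b\<in>UNIV. cyc_norm (push_line v b)) = 7 ^ 7 * R"
    using r by (simp add: pi_quotient_def R_def prod.distrib)
  have cyc_norm_snd: "cyc_norm (push_snd v) = 49 * cyc_norm s2"
    using s1 s2 by (simp add: pi_quotient_def)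
  \<comment> \<open>One factor 7 comes from the coefficient sum, seven from the lines of slope
    \<open>b\<close>, two from the remaining line.\<close>
  have det: "group_det v = 7 ^ 10 * (m * cyc_norm s2 * R)"
    unfolding group_det_eq m prod_push_line cyc_norm_snd by simp
  with D have nz: "m \<noteq> 0" "cyc_norm s2 \<noteq> 0" "R \<noteq> 0"
    by auto
  have r_nz: "cyc_norm (r b) \<noteq> 0" for b
    using nz(3) by (simp add: R_def)
  have R1: "of_int R = (1::7)"
    unfolding R_def using r0 by (rule prod_cyc_norm_mod7)
  have R_pos: "R > 0"
    unfolding R_def by (rule prod_pos) (use cyc_norm_nonneg r_nz in \<open>simp add: less_le\<close>)
  show ?thesis
  proof (cases "moment2 v 0 2 = 0")
    case False
    have "R \<ge> 43"
      unfolding R_def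
      by (rule prod_cyc_norm_ge_43[OF r0 r_nz sum_norm_Y[OF M(2) r] False])
    have abs_det: "\<bar>group_det v\<bar> = 7 ^ 10 * (\<bar>m * cyc_norm s2\<bar> * R)"
      unfolding det using R_pos by (simp add: abs_mult)
    have "m * cyc_norm s2 \<noteq> 0"
      using nz by simp
    then have "1 \<le> \<bar>m * cyc_norm s2\<bar>"
      by linarith
    then have "1 * 43 \<le> \<bar>m * cyc_norm s2\<bar> * R"
      using \<open>R \<ge> 43\<close> by (intro mult_mono) auto
    then have "43 * 7 ^ 10 \<le> \<bar>group_det v\<bar>"
      unfolding abs_det by (simp add: ac_simps)
    moreover have "8 * 7 ^ 11 \<le> \<bar>group_det v\<bar>" if "7 ^ 11 dvd group_det v"
    proof -
      have "(7::int) ^ 10 * 7 dvd 7 ^ 10 * (m * cyc_norm s2 * R)"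
        using that unfolding det by simp
      then have "7 dvd m * cyc_norm s2 * R"
        by (subst (asm) dvd_mult_cancel_left) simp
      \<comment> \<open>\<open>R\<close> is 1 modulo 7, so an eleventh factor 7 must come from the
        other cofactors.\<close>
      then have "of_int (m * cyc_norm s2) = (0::7)"
        using R1 unfolding of_int_Z7_eq_0_iff[symmetric] by simp
      then have "7 dvd m * cyc_norm s2"
        unfolding of_int_Z7_eq_0_iff .
      then have "7 \<le> \<bar>m * cyc_norm s2\<bar>"
        using nz by (intro abs_ge_of_dvd) auto
      then have "7 * 43 \<le> \<bar>m * cyc_norm s2\<bar> * R"
        using \<open>R \<ge> 43\<close> by (intro mult_mono) auto
      then show ?thesis
        unfolding abs_det by (simp add: ac_simps)
    qed
    ultimately show ?thesis
      by (simp add: det_bounds_def)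
  next
    case True
    \<comment> \<open>The vanishing of \<open>moment2 v 0 2\<close> allows a third division by the
      prime above 7 on the remaining line.\<close>
    have "moment 2 (push_snd v) = 2 * moment 0 s2"
      using s1 s2 \<open>moment 0 s1 = 0\<close> by (simp add: pi_quotient_def)
    then have "moment 0 s2 = 0"
      using True by (simp add: moment_push_snd mult_eq_0_Z7)
    then obtain s3 where s3: "pi_quotient s2 s3"
      using ex_pi_quotient by blast
    have det: "group_det v = 7 ^ 11 * (m * cyc_norm s3 * R)"
      unfolding det using s3 by (simp add: pi_quotient_def)
    show ?thesis
    proof (cases "7 dvd m \<or> 7 dvd cyc_norm s3")
      case True
      then have "7 dvd m * cyc_norm s3 * R"
        by auto
      then have "7 ^ 11 * 7 dvd group_det v"
        unfolding det by (rule mult_dvd_mono[OF dvd_refl])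
      then show ?thesis
        using D by (intro det_bounds_of_dvd) simp_all
    next
      case False
      have s30: "moment 0 s3 \<noteq> 0"
        using False cyc_norm_mod7[of s3] by (auto simp flip: of_int_Z7_eq_0_iff)
      \<comment> \<open>Otherwise all cofactors are units and \<open>det_unit_case\<close> makes
        \<open>m\<close> divisible by 7. Being 1 modulo 7, the product
        \<open>cyc_norm s3 * R\<close> is then at least 8.\<close>
      have "\<not> (R = 1 \<and> cyc_norm s3 = 1)"
      proof
        assume *: "R = 1 \<and> cyc_norm s3 = 1"
        have "cyc_norm (r b) = 1" for b
        proof -
          have "cyc_norm (r b) dvd R"
            unfolding R_def by (rule dvd_prodI) auto
          then show ?thesis
            using * cyc_norm_nonneg[of "r b"] by auto
        qed
        moreover have "moment 3 (push_snd v) = 6 * moment 0 s3"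
          using s1 s2 s3 \<open>moment 0 s1 = 0\<close> \<open>moment 0 s2 = 0\<close> by (simp add: pi_quotient_def numeral_Z7)
        then have "moment2 v 0 3 \<noteq> 0"
          using s30 by (auto simp: moment_push_snd mult_eq_0_Z7)
        moreover have "ev (push_snd v) a = (chi a - 1) ^ 3 * ev s3 a" if "a \<noteq> 0" for a
          using s1 s2 s3 that by (simp add: pi_quotient_def power3_eq_cube)
        moreover have "ev (push_line v b) a = (chi a - 1) * ev (r b) a" if "a \<noteq> 0" for a b
          using r[of b] that by (simp add: pi_quotient_def)
        ultimately have "49 dvd (\<Sum>g\<in>UNIV. v $ g)"
          using M True * by (intro det_unit_case[of v r s3]) auto
        then have "7 dvd m"
          unfolding m by presburger
        with False show False
          by simp
      qed
      moreover have "cyc_norm s3 > 0"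
        using cyc_norm_nonneg[of s3] False by (auto simp: le_less)
      ultimately have "cyc_norm s3 * R \<noteq> 1" "cyc_norm s3 * R > 0"
        using R_pos by (auto simp: pos_zmult_eq_1_iff)
      moreover have "7 dvd cyc_norm s3 * R - 1"
      proof -
        have "of_int (cyc_norm s3 * R - 1) = (0::7)"
          using R1 fermat_Z7[OF s30] by (simp add: cyc_norm_mod7)
        then show ?thesis
          unfolding of_int_Z7_eq_0_iff .
      qed
      ultimately have "8 \<le> cyc_norm s3 * R"
        by presburger
      moreover have "\<bar>group_det v\<bar> = 7 ^ 11 * (\<bar>m\<bar> * (cyc_norm s3 * R))"
        unfolding det using R_pos cyc_norm_nonneg[of s3] by (simp add: abs_mult)
      moreover have "1 * (cyc_norm s3 * R) \<le> \<bar>m\<bar> * (cyc_norm s3 * R)"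
        using nz R_pos cyc_norm_nonneg[of s3] by (intro mult_right_mono) auto
      ultimately have "8 \<le> \<bar>m\<bar> * (cyc_norm s3 * R)" "\<bar>group_det v\<bar> = 7 ^ 11 * (\<bar>m\<bar> * (cyc_norm s3 * R))"
        by simp_all
      then have "8 * 7 ^ 11 \<le> \<bar>group_det v\<bar>"
        by (simp add: ac_simps)
      then show ?thesis
        by (simp add: det_bounds_def)
    qed
  qed
qed

section \<open>Normalization of moments by automorphisms of the group\<close>

lemma group_det_reindex:
  assumes "\<And>c d. fourier w c d = fourier v (f c d) (g c d)" "bij (\<lambda>(c, d). (f c d, g c d))"
  shows "group_det w = group_det v"
proof -
  have "complex_of_int (group_det w)
    = (\<Prod>p\<in>UNIV. case (case p of (c, d) \<Rightarrow> (f c d, g c d)) of (c, d) \<Rightarrow> fourier v c d)"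
    by (simp add: group_det_eq_prod_fourier assms(1) case_prod_unfold)
  also have "\<dots> = of_int (group_det v)"
    unfolding group_det_eq_prod_fourier by (rule prod.reindex_bij_betw) (use assms(2) in simp)
  finally show ?thesis
    by simp
qed

lemma det_bounds_if_moment:
  assumes "moment2 v 0 0 = 0" "moment2 v 1 0 \<noteq> 0" "group_det v \<noteq> 0"
  shows "det_bounds (group_det v)"
proof -
  \<comment> \<open>\<open>k\<close> is \<open>B / A\<close>: the shear by \<open>k\<close> keeps
    \<open>A\<close> and replaces \<open>B\<close> by \<open>B - k * A = 0\<close>.\<close>
  define k where "k = moment2 v 0 1 * moment2 v 1 0 ^ 5"
  define w :: "(int, C7xC7) vec" where "w = (\<chi> g. v $ (fst g, snd g + k * fst g))"
  have sum_w: "(\<Sum>g\<in>UNIV. of_int (w $ g) * F g) = (\<Sum>(i, j)\<in>UNIV. of_int (v $ (i, j)) * F (i, j - k * i))"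
    for F :: "C7xC7 \<Rightarrow> 'a::comm_ring_1"
    by (rule sum.reindex_bij_witness[of _ "\<lambda>(i, j). (i, j - k * i)" "\<lambda>(i, j). (i, j + k * i)"])
      (auto simp: w_def)
  have fourier: "fourier w c d = fourier v (c - d * k) d" for c d
    unfolding fourier_alt sum_w by (simp add: fourier_def pair_chi_def case_prod_unfold algebra_simps)
  have moment: "moment2 w 0 0 = moment2 v 0 0" "moment2 w 1 0 = moment2 v 1 0"
    "moment2 w 0 1 = moment2 v 0 1 - k * moment2 v 1 0"
    using sum_w[of "\<lambda>_. 1 :: 7"] sum_w[of "\<lambda>g. fst g"] sum_w[of "\<lambda>g. snd g"]
    by (simp_all add: moment2_def case_prod_unfold algebra_simps sum_subtractf sum_distrib_left)
  have det: "group_det w = group_det v"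
    by (rule group_det_reindex[OF fourier], rule bij_betw_byWitness[where f'
      = "\<lambda>(c, d). (c + d * k, d)"]) auto
  have "k * moment2 v 1 0 = moment2 v 0 1"
    using fermat_Z7[OF assms(2)] by (simp add: k_def power_numeral_reduce mult_ac)
  then show ?thesis
    using det_bounds_normalized[of w] moment assms unfolding det by simp
qed

lemma det_bounds_of_7_dvd:
  fixes v :: "(int, C7xC7) vec"
  assumes "7 dvd group_det v" "group_det v \<noteq> 0"
  shows "det_bounds (group_det v)"
proof -
  \<comment> \<open>Modulo 7 each norm is the sixth power of the coefficient sum, and
    \<open>1 + 7 * 6 + 6 = 49\<close>.\<close>
  have "moment2 v 0 0 ^ 49 = (0::7)"
  proof -
    have "moment2 v 0 0 * (\<Prod>b\<in>(UNIV::7 set). moment2 v 0 0 ^ 6) * moment2 v 0 0 ^ 6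
      = of_int (group_det v)"
      unfolding group_det_eq
      by (simp add: cyc_norm_mod7 moment_push_line_expand moment_push_snd moment2_0_0)
    also have "\<dots> = 0"
      using assms(1) unfolding of_int_Z7_eq_0_iff .
    finally show ?thesis
      by (simp add: power_eq_0_Z7 mult_eq_0_Z7)
  qed
  then have M0: "moment2 v 0 0 = 0"
    by (simp add: power_eq_0_Z7)
  consider "moment2 v 1 0 \<noteq> 0" | "moment2 v 0 1 \<noteq> 0" | "moment2 v 1 0 = 0" "moment2 v 0 1 = 0"
    by blast
  then show ?thesis
  proof cases
    case 1
    then show ?thesis
      using M0 assms(2) by (intro det_bounds_if_moment)
  next
    case 2
    define w :: "(int, C7xC7) vec" where "w = (\<chi> g. v $ (snd g, fst g))"
    have sum_w: "(\<Sum>g\<in>UNIV. of_int (w $ g) * F g) = (\<Sum>(i, j)\<in>UNIV. of_int (v $ (i, j)) * F (j, i))"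
      for F :: "C7xC7 \<Rightarrow> 'a::comm_ring_1"
      by (rule sum.reindex_bij_witness[of _ "\<lambda>(i, j). (j, i)" "\<lambda>(i, j). (j, i)"]) (auto simp: w_def)
    have fourier: "fourier w c d = fourier v d c" for c d
      unfolding fourier_alt sum_w by (simp add: fourier_def pair_chi_def case_prod_unfold add.commute)
    have moment: "moment2 w 0 0 = moment2 v 0 0" "moment2 w 1 0 = moment2 v 0 1"
      using sum_w[of "\<lambda>_. 1 :: 7"] sum_w[of "\<lambda>g. fst g"]
      by (simp_all add: moment2_def case_prod_unfold)
    have det: "group_det w = group_det v"
      by (rule group_det_reindex[OF fourier], rule bij_betw_byWitness[where f' = "\<lambda>(c, d). (d, c)"]) auto
    show ?thesis
      using det_bounds_if_moment[of w] moment M0 2 assms(2) unfolding det by simp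
  next
    case 3
    have 49: "49 dvd cyc_norm q" if "moment 0 q = 0" "moment 1 q = 0" for q
    proof -
      obtain r where r: "pi_quotient q r"
        using ex_pi_quotient \<open>moment 0 q = 0\<close> by blast
      then have "moment 0 r = 0"
        using \<open>moment 1 q = 0\<close> by (simp add: pi_quotient_def)
      then obtain s where "pi_quotient r s"
        using ex_pi_quotient by blast
      with r show ?thesis
        by (simp add: pi_quotient_def)
    qed
    \<comment> \<open>The lines of slope \<open>b\<close> alone contribute
      \<open>49 ^ 7 = 7 ^ 14\<close>.\<close>
    have "(\<Prod>b\<in>(UNIV::7 set). 49) dvd (\<Prod>b\<in>UNIV. cyc_norm (push_line v b))"
      by (intro prod_dvd_prod 49) (simp_all add: moment_push_line_expand M0 3 del: One_nat_def)
    then have "(7::int) ^ 12 dvd (\<Prod>b\<in>UNIV. cyc_norm (push_line v b))"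
      by (rule dvd_trans[rotated]) simp
    then have "7 ^ 12 dvd group_det v"
      unfolding group_det_eq by simp
    then show ?thesis
      using assms(2) by (rule det_bounds_of_dvd)
  qed
qed

theorem corollary1p2:
  shows "is_least {s \<in> group_dets TYPE(C7xC7). s > 0 \<and> 7 dvd s} (43 * 7 ^ 10) \<and>
    is_least {s \<in> group_dets TYPE(C7xC7). s > 0 \<and> multiplicity 7 s = 11} (8 * 7 ^ 11) \<and>
    7 ^ 10 \<notin> group_dets TYPE(C7xC7) \<and> - (7 ^ 10) \<notin> group_dets TYPE(C7xC7) \<and>
    7 ^ 11 \<notin> group_dets TYPE(C7xC7) \<and> - (7 ^ 11) \<notin> group_dets TYPE(C7xC7) \<and>
    range (\<lambda>n::int. 7 ^ 12 * n) \<subseteq> group_dets TYPE(C7xC7)"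
proof -
  have det_bounds: "det_bounds s" if "s \<in> group_dets TYPE(C7xC7)" "7 dvd s" "s \<noteq> 0" for s
    using that det_bounds_of_7_dvd unfolding group_dets_def by blast
  have mem: "group_det v \<in> group_dets TYPE(C7xC7)" for v :: "(int, C7xC7) vec"
    by (simp add: group_dets_def)
  have "43 * 7 ^ 10 \<in> group_dets TYPE(C7xC7)"
    unfolding det_43[symmetric] by (rule mem)
  moreover have "43 * 7 ^ 10 \<le> s" if "s \<in> group_dets TYPE(C7xC7)" "s > 0" "7 dvd s" for s
    using det_bounds[of s] that by (simp add: det_bounds_def)
  ultimately have 1: "is_least {s \<in> group_dets TYPE(C7xC7). s > 0 \<and> 7 dvd s} (43 * 7 ^ 10)"
    by (simp add: is_least_def)
  have "multiplicity (7::int) (8 * 7 ^ 11) = 11"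
    by (rule multiplicity_eqI) simp_all
  moreover have "8 * 7 ^ 11 \<in> group_dets TYPE(C7xC7)"
    unfolding det_8[symmetric] by (rule mem)
  moreover have "8 * 7 ^ 11 \<le> s" if "s \<in> group_dets TYPE(C7xC7)" "s > 0" "multiplicity 7 s = 11" for s
  proof -
    have "7 ^ 11 dvd s"
      using multiplicity_dvd[of 7 s] that(3) by simp
    moreover have "\<not> 7 ^ 12 dvd s"
      using that(2,3) power_dvd_iff_le_multiplicity[of s 7 12] by simp
    moreover have "7 dvd s"
      using \<open>7 ^ 11 dvd s\<close> by (rule dvd_trans[rotated]) simp
    ultimately show ?thesis
      using det_bounds[of s] that by (simp add: det_bounds_def)
  qed
  ultimately have 2: "is_least {s \<in> group_dets TYPE(C7xC7). s > 0 \<and> multiplicity 7 s = 11} (8 * 7 ^ 11)"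
    by (simp add: is_least_def)
  have "\<not> det_bounds (7 ^ 10)" "\<not> det_bounds (- (7 ^ 10))" "\<not> det_bounds (7 ^ 11)"
    "\<not> det_bounds (- (7 ^ 11))"
    by (simp_all add: det_bounds_def)
  then have 3: "7 ^ 10 \<notin> group_dets TYPE(C7xC7)" "- (7 ^ 10) \<notin> group_dets TYPE(C7xC7)"
    "7 ^ 11 \<notin> group_dets TYPE(C7xC7)" "- (7 ^ 11) \<notin> group_dets TYPE(C7xC7)"
    using det_bounds by fastforce+
  have "range (\<lambda>n::int. 7 ^ 12 * n) \<subseteq> group_dets TYPE(C7xC7)"
    unfolding det_7_12[symmetric] using mem by blast
  with 1 2 3 show ?thesis
    by blast
qed

end
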